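(* Suppose that $l:\mathbf R\to\mathbf R$ is strictly convex, strictly decreasing, bounded from below and of class $C^1$, with $\lim_{x\to-\infty}l'(x)=-\infty$ and $\lim_{x\to+\infty}l'(x)=0$. Let $I:(-\infty,0)\to\mathbf R$ be the inverse function of $l'$. Suppose in addition that for any $k\in\{1,\ldots,n\}$, $\alpha_k>\lim_{x\to+\infty}l(x)$ and there exists a strictly negative random variable $Y_{k-1}\in\mathcal F_{k-1}$ such that $$\mathbb E^{\mathbb P}[l(I(Y_{k-1}Z_k/Z_{k-1}))]<+\infty,\quad\text{where } Z_k=\mathbb E^{\mathbb P}\Big[\frac{d\mathbb Q}{d\mathbb P}\,\Big|\,\mathcal F_k\Big].$$ Then the value function $V_t$ satisfies $V_t=\widehat V_t$ a.s. for $t=0,\ldots,n-1$, where $\widehat V_t$ is given by $$\widehat V_{n-1}=\mathbb E^{\mathbb Q}[S_n+I(\lambda_{n-1}Z_n/Z_{n-1})|\mathcal F_{n-1}],$$ where $\lambda_{n-1}\in\mathcal F_{n-1}$ is the solution of $$\mathbb E^{\mathbb P}[l(I(\lambda_{n-1}Z_n/Z_{n-1}))|\mathcal F_{n-1}]=\alpha_n,$$ and for $k<n$, $$\widehat V_{k-1}=\mathbb E^{\mathbb Q}[\widehat V_k|\mathcal F_{k-1}]+\mathbb E^{\mathbb Q}\Big[\big\{S_k-\widehat V_k+I(\lambda_{k-1}Z_k/Z_{k-1})\big\}^+\Big|\mathcal F_{k-1}\Big]\mathbf 1_{\{\mathbb E^{\mathbb P}[l(\widehat V_k-S_k)|\mathcal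 F_{k-1}]>\alpha_k\}},$$ where $\lambda_{k-1}\in\mathcal F_{k-1}$ is the solution of $$\mathbb E^{\mathbb P}\Big[l\Big(I(\lambda_{k-1}Z_k/Z_{k-1})\vee(\widehat V_k-S_k)\Big)\Big|\mathcal F_{k-1}\Big]=\alpha_k.$$
   Context: Setting: $(\Omega,\mathcal F,\mathbb P)$ is a probability space with a discrete filtration $\mathbb F=(\mathcal F_k)_{k=0}^n$, $n\ge 1$, with $\mathcal F_0$ trivial; $\mathbb Q$ is a probability measure equivalent to $\mathbb P$; $S_0=0$ and $S_k=P_1+\dots+P_k$, where each $P_i$ is $\mathcal F_i$-measurable with $\mathbb E^{\mathbb Q}[|P_i|]<\infty$. $\alpha_1,\ldots,\alpha_n$ are real numbers. The notation $M\in\mathcal F_k$ means that $M$ is an $\mathcal F_k$-measurable random variable; $x^+=\max(x,0)$ and $a\vee b=\max(a,b)$. The random variables $\lambda_{k-1}$ take strictly negative values (the domain of $I$ is $(-\infty,0)$). The value function (time-consistent constraint) is the process $(V_k)_{0\le k\le n}$ defined backward by $V_n=-\infty$ and, for $k\in\{1,\ldots,n\}$, $$V_{k-1}=\operatorname*{ess\,inf}_{M\in\mathcal F_k}\{\mathbb E^{\mathbb Q}[M|\mathcal F_{k-1}] : M\geq V_k \text{ and } \mathbb E^{\mathbb P}[l(M-S_k)|\mathcal F_{k-1}]\leq\alpha_k\}.$$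
   Formalization: The stated hypotheses ensure neither that λ_{k-1} exists nor that the formula for V̂_{k-1} avoids −∞+∞; both are assumed. For k<n the λ-equation is required only where E^P[l(V̂_k−S_k)|F_{k-1}]>α_k, since it is unsolvable where this expectation is below α_k. *)

theory Defs
  imports "HOL-Probability.Probability"
begin

definition strictly_convex :: "(real \<Rightarrow> real) \<Rightarrow> bool" where
  "strictly_convex f \<longleftrightarrow>
    (\<forall>x y t. x \<noteq> y \<longrightarrow> 0 < t \<longrightarrow> t < 1 \<longrightarrow>
      f ((1 - t) * x + t * y) < (1 - t) * f x + t * f y)"

text \<open>
  Conditional expectation of an extended real random variable, as the difference of the
  conditional expectations of its positive and negative parts (\<^const>\<open>e2ennreal\<close> sends negative
  numbers to 0). Where both are infinite the value is \<open>\<infinity>\<close>, because \<open>\<infinity> - \<infinity> = \<infinity>\<close> in \<^typ>\<open>ereal\<close>;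
  hence a variable without conditional expectation never lowers an essential infimum.
\<close>

definition ext_cond_exp :: "'a measure \<Rightarrow> 'a measure \<Rightarrow> ('a \<Rightarrow> ereal) \<Rightarrow> 'a \<Rightarrow> ereal" where
  "ext_cond_exp M G X \<omega> =
     enn2ereal (nn_cond_exp M G (\<lambda>\<omega>. e2ennreal (X \<omega>)) \<omega>)
   - enn2ereal (nn_cond_exp M G (\<lambda>\<omega>. e2ennreal (- X \<omega>)) \<omega>)"

lemma (in sigma_finite_subalgebra) ext_cond_exp_integrable:
  assumes "integrable M X"
  shows "AE \<omega> in M. ext_cond_exp M F (\<lambda>\<omega>. ereal (X \<omega>)) \<omega> = ereal (real_cond_exp M F X \<omega>)"
proof -
  have [measurable]: "X \<in> borel_measurable M" using assms by auto
  have fin: "AE \<omega> in M. nn_cond_exp M F (\<lambda>x. ennreal (Y x)) \<omega> \<noteq> \<infinity>" if "integrable M Y" for Y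
  proof (rule nn_integral_PInf_AE)
    have [measurable]: "Y \<in> borel_measurable M" using that by auto
    show "nn_cond_exp M F (\<lambda>x. ennreal (Y x)) \<in> borel_measurable M" by simp
    have "(\<integral>\<^sup>+x. nn_cond_exp M F (\<lambda>x. ennreal (Y x)) x \<partial>M) = (\<integral>\<^sup>+x. ennreal (Y x) \<partial>M)"
      using nn_cond_exp_intg[of "\<lambda>_. 1" "\<lambda>x. ennreal (Y x)"] by simp
    also have "\<dots> < \<infinity>" using that by (simp add: real_integrable_def less_top)
    finally show "(\<integral>\<^sup>+x. nn_cond_exp M F (\<lambda>x. ennreal (Y x)) x \<partial>M) \<noteq> \<infinity>" by simp
  qed
  have eq: "e2ennreal (ereal r) = ennreal r" for r by (simp add: ennreal.rep_eq e2ennreal_def ennreal_def)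
  show ?thesis
    using fin[OF assms] fin[of "\<lambda>x. - X x", OF integrable_minus[OF assms]]
  proof eventually_elim
    case (elim \<omega>)
    then obtain a b where "nn_cond_exp M F (\<lambda>x. ennreal (X x)) \<omega> = ennreal a" "0 \<le> a"
      "nn_cond_exp M F (\<lambda>x. ennreal (- X x)) \<omega> = ennreal b" "0 \<le> b"
      by (metis ennreal_cases infinity_ennreal_def)
    then show ?case
      by (simp add: ext_cond_exp_def real_cond_exp_def eq enn2ereal_ennreal)
  qed
qed

text \<open>\<^term>\<open>v\<close> is (a version of) the essential infimum of the family \<^term>\<open>\<X>\<close>.\<close>

definition is_ess_inf :: "'a measure \<Rightarrow> ('a \<Rightarrow> ereal) set \<Rightarrow> ('a \<Rightarrow> ereal) \<Rightarrow> bool" where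
  "is_ess_inf M \<X> v \<longleftrightarrow>
     v \<in> borel_measurable M \<and>
     (\<forall>X\<in>\<X>. AE \<omega> in M. v \<omega> \<le> X \<omega>) \<and>
     (\<forall>w\<in>borel_measurable M. (\<forall>X\<in>\<X>. AE \<omega> in M. w \<omega> \<le> X \<omega>) \<longrightarrow> (AE \<omega> in M. w \<omega> \<le> v \<omega>))"

definition cum :: "(nat \<Rightarrow> 'a \<Rightarrow> real) \<Rightarrow> nat \<Rightarrow> 'a \<Rightarrow> real" where
  "cum p k \<omega> = (\<Sum>i=1..k. p i \<omega>)"

definition density_process ::
    "'a measure \<Rightarrow> 'a measure \<Rightarrow> (nat \<Rightarrow> 'a measure) \<Rightarrow> nat \<Rightarrow> 'a \<Rightarrow> real" where
  "density_process P Q F k = real_cond_exp P (F k) (\<lambda>\<omega>. enn2real (RN_deriv P Q \<omega>))"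

text \<open>
  The inverse of \<open>l'\<close>. When \<open>l'\<close> is injective with range \<open>{..<0}\<close>, only the values of
  \<^term>\<open>marginal_inverse l\<close> at negative arguments are meaningful.
\<close>

definition marginal_inverse :: "(real \<Rightarrow> real) \<Rightarrow> real \<Rightarrow> real" where
  "marginal_inverse l = the_inv (deriv l)"

text \<open>\<open>I(y Z\<^sub>k / Z\<^sub>k\<^sub>-\<^sub>1)\<close> for a random multiplier \<open>y\<close>.\<close>

definition optimizer ::
    "'a measure \<Rightarrow> 'a measure \<Rightarrow> (nat \<Rightarrow> 'a measure) \<Rightarrow> (real \<Rightarrow> real) \<Rightarrow> nat \<Rightarrow>
     ('a \<Rightarrow> real) \<Rightarrow> 'a \<Rightarrow> real" where
  "optimizer P Q F l k y \<omega> =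
     marginal_inverse l (y \<omega> * density_process P Q F k \<omega> / density_process P Q F (k - 1) \<omega>)"

text \<open>
  Extension of the loss function to extended real arguments by its limits; at \<open>-\<infinity>\<close> the limit
  is \<open>\<infinity>\<close> as soon as \<open>l\<close> is convex and strictly decreasing.
\<close>

definition ext_loss :: "(real \<Rightarrow> real) \<Rightarrow> ereal \<Rightarrow> ereal" where
  "ext_loss l x =
     (if x = \<infinity> then ereal (Lim at_top l)
      else if x = - \<infinity> then \<infinity>
      else ereal (l (real_of_ereal x)))"

definition is_value_process ::
    "'a measure \<Rightarrow> 'a measure \<Rightarrow> (nat \<Rightarrow> 'a measure) \<Rightarrow> nat \<Rightarrow> (nat \<Rightarrow> 'a \<Rightarrow> real) \<Rightarrow>
     (real \<Rightarrow> real) \<Rightarrow> (nat \<Rightarrow> real) \<Rightarrow> (nat \<Rightarrow> 'a \<Rightarrow> ereal) \<Rightarrow> bool" where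
  "is_value_process P Q F n S l \<alpha> V \<longleftrightarrow>
     (AE \<omega> in P. V n \<omega> = - \<infinity>) \<and>
     (\<forall>k\<in>{1..n}.
        is_ess_inf P
          {ext_cond_exp Q (F (k - 1)) (\<lambda>\<omega>. ereal (M \<omega>)) | M :: 'a \<Rightarrow> real.
             M \<in> borel_measurable (F k) \<and>
             (AE \<omega> in P. V k \<omega> \<le> ereal (M \<omega>)) \<and>
             (AE \<omega> in P.
                ext_cond_exp P (F (k - 1)) (\<lambda>\<omega>. ereal (l (M \<omega> - S k \<omega>))) \<omega> \<le> ereal (\<alpha> k))}
          (V (k - 1)))"

text \<open>
  The explicit recursion, as a relation between the multipliers \<^term>\<open>lam\<close> and the candidate
  \<^term>\<open>W\<close>. For \<open>k < n\<close> the expected loss cannot exceed \<open>E[l(W\<^sub>k - S\<^sub>k) | F\<^sub>k\<^sub>-\<^sub>1]\<close>, so the equation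
  for the multiplier can be solved only where this is at least \<open>\<alpha>\<^sub>k\<close>. Accordingly it is imposed
  only on the event \<open>E[l(W\<^sub>k - S\<^sub>k) | F\<^sub>k\<^sub>-\<^sub>1] > \<alpha>\<^sub>k\<close>, the only place where the multiplier is used.
  The clause with \<open>\<not>\<close> says that the sum defining \<open>W\<^sub>k\<^sub>-\<^sub>1\<close> is not of the form \<open>-\<infinity> + \<infinity>\<close>.
\<close>

definition is_explicit_process ::
    "'a measure \<Rightarrow> 'a measure \<Rightarrow> (nat \<Rightarrow> 'a measure) \<Rightarrow> nat \<Rightarrow> (nat \<Rightarrow> 'a \<Rightarrow> real) \<Rightarrow>
     (real \<Rightarrow> real) \<Rightarrow> (nat \<Rightarrow> real) \<Rightarrow> (nat \<Rightarrow> 'a \<Rightarrow> real) \<Rightarrow> (nat \<Rightarrow> 'a \<Rightarrow> ereal) \<Rightarrow> bool" where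
  "is_explicit_process P Q F n S l \<alpha> lam W \<longleftrightarrow>
     (\<forall>t<n. lam t \<in> borel_measurable (F t) \<and> (AE \<omega> in P. lam t \<omega> < 0) \<and>
            W t \<in> borel_measurable (F t)) \<and>
     (AE \<omega> in P.
        ext_cond_exp P (F (n - 1)) (\<lambda>\<omega>. ereal (l (optimizer P Q F l n (lam (n - 1)) \<omega>))) \<omega>
          = ereal (\<alpha> n)) \<and>
     (AE \<omega> in P.
        W (n - 1) \<omega> =
          ext_cond_exp Q (F (n - 1))
            (\<lambda>\<omega>. ereal (S n \<omega> + optimizer P Q F l n (lam (n - 1)) \<omega>)) \<omega>) \<and>
     (\<forall>k\<in>{1..<n}.
        let \<xi> = optimizer P Q F l k (lam (k - 1));
            A = {\<omega>. ext_cond_exp P (F (k - 1))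
                      (\<lambda>\<omega>. ext_loss l (W k \<omega> - ereal (S k \<omega>))) \<omega> > ereal (\<alpha> k)};
            C = ext_cond_exp Q (F (k - 1)) (W k);
            D = ext_cond_exp Q (F (k - 1))
                  (\<lambda>\<omega>. max (ereal (S k \<omega>) - W k \<omega> + ereal (\<xi> \<omega>)) 0)
        in (AE \<omega> in P. \<omega> \<in> A \<longrightarrow>
              ext_cond_exp P (F (k - 1))
                (\<lambda>\<omega>. ext_loss l (max (ereal (\<xi> \<omega>)) (W k \<omega> - ereal (S k \<omega>)))) \<omega> = ereal (\<alpha> k)) \<and>
           (AE \<omega> in P. \<not> (C \<omega> = - \<infinity> \<and> D \<omega> * indicator A \<omega> = \<infinity>)) \<and>
           (AE \<omega> in P. W (k - 1) \<omega> = C \<omega> + D \<omega> * indicator A \<omega>))"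

end

(*
  Write W for the candidate Vhat (with W_n = -infinity) and let N be the larger of W_k and
  S_k + I(lambda_{k-1} Z_k / Z_{k-1}) where W_k violates the loss constraint, and W_k elsewhere.
  Then W_{k-1} = E^Q[N | F_{k-1}], and N is admissible by
  construction. If M is another admissible position, the tangent of l at N - S_k, together with
  M >= W_k where N = W_k, gives
    l (M - S_k) >= l (N - S_k) + lambda (Z_k / Z_{k-1}) (M - N),
  and the conditional P-expectation of this turns, by Bayes' formula, into
  E^Q[N | F_{k-1}] <= E^Q[M | F_{k-1}]. Since conditional expectations may be infinite, all
  inequalities are rearranged into sums of nonnegative terms. The positive parts are controlled by
  |y| I(y) <= l(0) - inf l and by comparison with max W_k (S_k + c) for a constant c.
*)
theory Submission
  imports Defs
begin

section \<open>Smooth loss functions\<close>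

text \<open>The candidate may take the value -\<infinity>, whereas admissible positions are real
  valued and \<infinity> - \<infinity> equals \<infinity> in the extended reals, so finiteness has
  to be secured at several places. Where W_k already satisfies the loss constraint, its conditional
  expected loss is finite; the extended loss is \<infinity> at -\<infinity>, so W_k > -\<infinity>
  there. This makes N a real position. The two controls of positive parts serve different purposes.
  With xi = I(lambda_{k-1} Z_k / Z_{k-1}) and C = l(0) - inf l, the first gives E^Q[xi^+ | F_{k-1}]
  <= C / |lambda_{k-1}|. This is finite almost surely, which suffices inside one step, but 1 /
  |lambda_{k-1}| need not be integrable, so the bound cannot be handed to the next step. What is
  handed on is integrability of the positive part of the candidate under Q, and the constant c
  yields it because max W_k (S_k + c) is an admissible competitor with Q-integrable positive
  part.\<close>

locale smooth_loss =
  fixes l :: "real \<Rightarrow> real"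
  assumes convex: "strictly_convex l"
    and decreasing: "x < y \<Longrightarrow> l y < l x"
    and bounded: "bdd_below (range l)"
    and C1: "l C1_differentiable_on UNIV"
    and deriv_at_bot: "filterlim (deriv l) at_bot at_bot"
    and deriv_at_top: "(deriv l \<longlongrightarrow> 0) at_top"
begin

lemma has_deriv: "(l has_real_derivative deriv l x) (at x)"
  and continuous_deriv: "continuous_on UNIV (deriv l)"
proof -
  obtain D where D: "\<And>x. (l has_vector_derivative D x) (at x)" "continuous_on UNIV D"
    using C1 unfolding C1_differentiable_on_def by auto
  then have D': "(l has_real_derivative D x) (at x)" for x
    by (simp add: has_real_derivative_iff_has_vector_derivative)
  then have "deriv l = D" by (auto intro: DERIV_imp_deriv)
  then show "(l has_real_derivative deriv l x) (at x)" "continuous_on UNIV (deriv l)"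
    using D D' by auto
qed

lemma continuous_loss: "continuous_on UNIV l"
  using has_deriv by (meson DERIV_isCont continuous_at_imp_continuous_on)

lemma borel_loss [measurable]: "l \<in> borel_measurable borel"
  using continuous_loss by (rule borel_measurable_continuous_onI)

lemma tangent: "l x + deriv l x * (y - x) \<le> l y"
proof -
  have "convex_on UNIV l"
  proof (rule convex_onI)
    fix t x y :: real assume "0 < t" "t < 1"
    then show "l ((1 - t) *\<^sub>R x + t *\<^sub>R y) \<le> (1 - t) * l x + t * l y"
      using convex[unfolded strictly_convex_def, rule_format, of x y t]
      by (cases "x = y") (auto simp: algebra_simps)
  qed simp
  from convex_on_imp_above_tangent[OF this _ _ _ has_deriv, of x y] show ?thesis by simp
qed

lemma deriv_neg: "deriv l x < 0"
  using tangent[of x "x + 1"] decreasing[of x "x + 1"] by simp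

text \<open>The tangents at x and y give monotonicity. Equal slopes would turn both tangents into
  the chord, whose value at the midpoint would then be at most that of \<open>l\<close>, against
  strict convexity.\<close>

lemma deriv_strict_mono: "x < y \<Longrightarrow> deriv l x < deriv l y"
proof -
  assume "x < y"
  have a: "l x + deriv l x * (y - x) \<le> l y" "l y + deriv l y * (x - y) \<le> l x"
    by (rule tangent)+
  then have "0 \<le> (deriv l y - deriv l x) * (y - x)" by (simp add: algebra_simps)
  then have "deriv l x \<le> deriv l y" using \<open>x < y\<close> by (simp add: zero_le_mult_iff)
  moreover have "deriv l x \<noteq> deriv l y"
  proof
    assume eq: "deriv l x = deriv l y"
    have "l ((1 - 1/2) * x + 1/2 * y) < (1 - 1/2) * l x + 1/2 * l y"
      using \<open>x < y\<close> by (intro convex[unfolded strictly_convex_def, rule_format]) auto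
    moreover have "l x + deriv l x * ((1 - 1/2) * x + 1/2 * y - x) \<le> l ((1 - 1/2) * x + 1/2 * y)"
      by (rule tangent)
    ultimately show False using a eq by (simp add: algebra_simps)
  qed
  ultimately show ?thesis by simp
qed

lemma deriv_le_iff: "deriv l x \<le> deriv l y \<longleftrightarrow> x \<le> y"
  using deriv_strict_mono by (metis linorder_not_le less_le)

text \<open>The two limits of \<open>deriv l\<close> provide a point of slope at most y and one of
  slope above y; the intermediate value theorem puts y into the range, and strict monotonicity gives
  the injectivity that \<open>the_inv\<close> needs.\<close>

lemma deriv_marginal_inverse: 
  assumes "y < 0" shows "deriv l (marginal_inverse l y) = y"
proof -
  have inj: "inj (deriv l)"
    by (rule injI) (metis deriv_le_iff antisym order_refl)
  have "eventually (\<lambda>x. deriv l x \<le> y) at_bot"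
    using deriv_at_bot unfolding filterlim_at_bot by blast
  then obtain a where a: "deriv l a \<le> y" by (meson eventually_at_bot_linorder order_refl)
  have "eventually (\<lambda>x. y < deriv l x) at_top"
    using deriv_at_top assms by (simp add: order_tendstoD)
  then obtain b where b: "y < deriv l b" by (meson eventually_at_top_linorder order_refl)
  have "a \<le> b" using a b deriv_le_iff[of a b] by linarith
  then obtain x where "deriv l x = y"
    using IVT'[of "deriv l" a y b] a b continuous_on_subset[OF continuous_deriv] by force
  then show ?thesis
    unfolding marginal_inverse_def using inj by (metis the_inv_f_f)
qed

text \<open>Off the negative half-line \<open>marginal_inverse l\<close> is the constant \<open>THE x. False\<close>.\<close>

lemma borel_marginal_inverse [measurable]: "marginal_inverse l \<in> borel_measurable borel"
proof (rule borel_measurableI_le)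
  fix a
  have le: "marginal_inverse l y \<le> a \<longleftrightarrow> y \<le> deriv l a" if "y < 0" for y
    using deriv_le_iff[of "marginal_inverse l y" a] deriv_marginal_inverse[OF that] by simp
  have const: "marginal_inverse l y = (THE x. False)" if "\<not> y < 0" for y
  proof -
    have "(\<lambda>x. x \<in> UNIV \<and> deriv l x = y) = (\<lambda>x. False)"
      using deriv_neg that by auto
    then show ?thesis unfolding marginal_inverse_def the_inv_into_def by simp
  qed
  have "{y \<in> space borel. marginal_inverse l y \<le> a} =
     {y. y < 0 \<and> y \<le> deriv l a} \<union> {y. \<not> y < 0 \<and> (THE x. False) \<le> a}"
    (is "?L = ?R")
  proof (rule set_eqI)
    fix x show "x \<in> ?L \<longleftrightarrow> x \<in> ?R" using le[of x] const[of x] by (cases "x < 0") auto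
  qed
  then show "{y \<in> space borel. marginal_inverse l y \<le> a} \<in> sets borel" by simp
qed

lemma loss_tendsto: "(l \<longlongrightarrow> (INF x. l x)) at_top"
proof (rule order_tendstoI)
  fix a assume "a < (INF x. l x)"
  then show "eventually (\<lambda>x. a < l x) at_top"
    by (intro always_eventually allI) (meson bounded cINF_lower UNIV_I order_less_le_trans)
next
  fix a assume "(INF x. l x) < a"
  then obtain x where "l x < a" using bounded by (auto simp: cINF_less_iff)
  then have "l y < a" if "y \<ge> x" for y
    using that decreasing[of x y] by (cases "x = y") auto
  then show "eventually (\<lambda>x. l x < a) at_top" unfolding eventually_at_top_linorder by blast
qed

lemma Lim_loss: "Lim at_top l = (INF x. l x)"
  by (intro tendsto_Lim loss_tendsto) simp

text \<open>The lower bound on each \<alpha> k enters here: it provides a constant reserve whose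
  loss stays below the threshold.\<close>

lemma ex_loss_less: "Lim at_top l < a \<Longrightarrow> \<exists>c. l c < a"
  using bounded by (simp add: Lim_loss cINF_less_iff)

lemma antimono_loss: "x \<le> y \<Longrightarrow> l y \<le> l x"
  using decreasing[of x y] by (cases "x = y") auto

lemma loss_lower: "(INF x. l x) \<le> l x"
  by (rule cINF_lower[OF bounded]) simp

lemma ext_loss_lower: "ereal (INF x. l x) \<le> ext_loss l x"
  by (simp add: ext_loss_def Lim_loss loss_lower)

lemma ext_loss_real [simp]: "ext_loss l (ereal x) = ereal (l x)"
  by (simp add: ext_loss_def)

lemma borel_ext_loss [measurable]: "ext_loss l \<in> borel_measurable borel"
  unfolding ext_loss_def[abs_def] by measurable

text \<open>Complementary slackness, to be used with b = N - S, c = \<xi> and x = M - S. Where the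
  bound \<open>W\<close> is active, c lies below b, so the slope at c is steeper; since x - b is
  nonnegative there, the tangent inequality survives the change of slope.\<close>

lemma deriv_mult_diff_le:
  assumes "c = b \<or> (c \<le> b \<and> b \<le> x)"
  shows "l b + deriv l c * (x - b) \<le> l x"
proof -
  have "deriv l c * (x - b) \<le> deriv l b * (x - b)"
    using assms by (cases "c = b") (auto intro!: mult_right_mono simp: deriv_le_iff)
  with tangent[of b x] show ?thesis by linarith
qed

text \<open>This is the tangent at x evaluated at 0. For x = I(y) the left side is |y| I(y).\<close>

lemma deriv_mult_le: "- deriv l x * x \<le> l 0 - (INF x. l x)"
  using tangent[of x 0] loss_lower[of x] by simp

end

section \<open>Extended conditional expectations\<close>

text \<open>Finiteness of a excludes \<infinity> - \<infinity> on the left, where its value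
  \<infinity> would do harm; on the right that value is harmless.\<close>

lemma enn2ereal_diff_mono:
  assumes "a \<noteq> \<top>" "a + d \<le> c + b"
  shows "enn2ereal a - enn2ereal b \<le> enn2ereal c - enn2ereal d"
  using assms
  by (cases a; cases b; cases c; cases d) (auto simp flip: ennreal_plus simp: top_unique)

lemma enn2ereal_diff_leD:
  assumes "b \<noteq> \<top>" "c \<noteq> \<top>" "enn2ereal a - enn2ereal b \<le> enn2ereal c - enn2ereal d"
  shows "a + d \<le> c + b"
  using assms
  by (cases a; cases b; cases c; cases d) (auto simp flip: ennreal_plus simp: top_unique)

context sigma_finite_subalgebra
begin

lemma sets_subalg: "A \<in> sets F \<Longrightarrow> A \<in> sets M"
  using subalg by (auto simp: subalgebra_def)

text \<open>The indicator of an event of the conditioning algebra can be pulled out of the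
  conditional expectation. Such local versions allow separate arguments where the loss constraint is
  violated and where it is not.\<close>

lemma nn_cond_exp_mono_on:
  assumes A: "A \<in> sets F" and le: "AE x in M. x \<in> A \<longrightarrow> f x \<le> g x"
    and [measurable]: "f \<in> borel_measurable M" "g \<in> borel_measurable M"
  shows "AE x in M. x \<in> A \<longrightarrow> nn_cond_exp M F f x \<le> nn_cond_exp M F g x"
proof -
  have [measurable]: "A \<in> sets F" "A \<in> sets M" using A sets_subalg by auto
  have "AE x in M. indicator A x * f x \<le> indicator A x * g x"
    using le by eventually_elim (auto simp: indicator_def)
  then have "AE x in M. nn_cond_exp M F (\<lambda>x. indicator A x * f x) x
      \<le> nn_cond_exp M F (\<lambda>x. indicator A x * g x) x"
    by (rule nn_cond_exp_mono) auto
  moreover have "AE x in M. indicator A x * nn_cond_exp M F f x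
      = nn_cond_exp M F (\<lambda>x. indicator A x * f x) x"
    by (rule nn_cond_exp_prod) auto
  moreover have "AE x in M. indicator A x * nn_cond_exp M F g x
      = nn_cond_exp M F (\<lambda>x. indicator A x * g x) x"
    by (rule nn_cond_exp_prod) auto
  ultimately show ?thesis
    by eventually_elim (metis indicator_simps(1) mult_1)
qed

lemma nn_cond_exp_cong_on:
  assumes "A \<in> sets F" "AE x in M. x \<in> A \<longrightarrow> f x = g x"
    and "f \<in> borel_measurable M" "g \<in> borel_measurable M"
  shows "AE x in M. x \<in> A \<longrightarrow> nn_cond_exp M F f x = nn_cond_exp M F g x"
proof -
  have "AE x in M. x \<in> A \<longrightarrow> f x \<le> g x" "AE x in M. x \<in> A \<longrightarrow> g x \<le> f x"
    using assms(2) by auto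
  from this[THEN nn_cond_exp_mono_on[OF assms(1)]] assms(3,4)
  have "AE x in M. x \<in> A \<longrightarrow> nn_cond_exp M F f x \<le> nn_cond_exp M F g x"
    "AE x in M. x \<in> A \<longrightarrow> nn_cond_exp M F g x \<le> nn_cond_exp M F f x" by auto
  then show ?thesis by eventually_elim auto
qed

text \<open>With B the event where f is infinite, f dominates \<infinity> times the indicator of B.
  Where the conditional expectation of f is finite, the conditional probability of B must therefore
  vanish. No integrability of f is assumed, so the conclusion is local.\<close>

lemma nn_cond_exp_finite_imp:
  assumes [measurable]: "f \<in> borel_measurable M"
  shows "AE x in M. nn_cond_exp M F f x < \<infinity> \<longrightarrow> f x < \<infinity>"
proof -
  define B where "B = {x \<in> space M. f x = \<infinity>}"
  define E where "E = {x \<in> space F. nn_cond_exp M F f x < \<infinity>}"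
  let ?g = "\<lambda>x. \<infinity> * indicator B x :: ennreal" and ?h = "nn_cond_exp M F (indicator B)"
  have [measurable]: "B \<in> sets M" unfolding B_def by measurable
  have E [measurable]: "E \<in> sets F" unfolding E_def by measurable
  have [measurable]: "E \<in> sets M" using E by (rule sets_subalg)
  have "AE x in M. ?g x \<le> f x" by (auto simp: indicator_def B_def)
  then have "AE x in M. nn_cond_exp M F ?g x \<le> nn_cond_exp M F f x"
    by (rule nn_cond_exp_mono) auto
  moreover have "AE x in M. \<infinity> * ?h x = nn_cond_exp M F ?g x"
    by (rule nn_cond_exp_prod) auto
  ultimately have 0: "AE x in M. x \<in> E \<longrightarrow> ?h x = 0"
  proof eventually_elim
    case (elim x)
    show ?case
    proof
      assume "x \<in> E"
      then have "\<infinity> * ?h x < \<infinity>" using elim by (auto simp: E_def intro: le_less_trans)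
      then show "?h x = 0" by (auto simp: ennreal_top_mult split: if_splits)
    qed
  qed
  have "(\<integral>\<^sup>+x. indicator E x * indicator B x \<partial>M) = (\<integral>\<^sup>+x. indicator E x * ?h x \<partial>M)"
    by (rule nn_cond_exp_intg[symmetric]) auto
  also have "\<dots> = (\<integral>\<^sup>+x. 0 \<partial>M)"
    by (rule nn_integral_cong_AE) (use 0 in \<open>auto simp: indicator_def elim!: eventually_mono\<close>)
  finally have "(\<integral>\<^sup>+x. indicator E x * indicator B x \<partial>M) = 0" by simp
  then have "AE x in M. indicator E x * indicator B x = (0::ennreal)"
    by (subst (asm) nn_integral_0_iff_AE) auto
  then show ?thesis
    using AE_space
    by eventually_elim
      (use subalg in \<open>auto simp: indicator_def B_def E_def subalgebra_def less_top split: if_splits\<close>)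
qed

lemma borel_ext_cond_exp [measurable]: "ext_cond_exp M F X \<in> borel_measurable F"
  unfolding ext_cond_exp_def[abs_def] by measurable

lemma ext_cond_exp_mono_on:
  assumes A: "A \<in> sets F" and le: "AE x in M. x \<in> A \<longrightarrow> X x \<le> Y x"
    and [measurable]: "X \<in> borel_measurable M" "Y \<in> borel_measurable M"
  shows "AE x in M. x \<in> A \<longrightarrow> ext_cond_exp M F X x \<le> ext_cond_exp M F Y x"
proof -
  have "AE x in M. x \<in> A \<longrightarrow> nn_cond_exp M F (\<lambda>x. e2ennreal (X x)) x
      \<le> nn_cond_exp M F (\<lambda>x. e2ennreal (Y x)) x"
    using le by (intro nn_cond_exp_mono_on[OF A]) (auto intro: e2ennreal_mono elim!: eventually_mono)
  moreover have "AE x in M. x \<in> A \<longrightarrow> nn_cond_exp M F (\<lambda>x. e2ennreal (- Y x)) x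
      \<le> nn_cond_exp M F (\<lambda>x. e2ennreal (- X x)) x"
    using le by (intro nn_cond_exp_mono_on[OF A]) (auto intro: e2ennreal_mono elim!: eventually_mono)
  ultimately show ?thesis
    unfolding ext_cond_exp_def
    by eventually_elim (auto intro!: ereal_minus_mono simp: less_eq_ennreal.rep_eq)
qed

lemma ext_cond_exp_cong_on:
  assumes A: "A \<in> sets F" and "AE x in M. x \<in> A \<longrightarrow> X x = Y x"
    and [measurable]: "X \<in> borel_measurable M" "Y \<in> borel_measurable M"
  shows "AE x in M. x \<in> A \<longrightarrow> ext_cond_exp M F X x = ext_cond_exp M F Y x"
proof -
  have "AE x in M. x \<in> A \<longrightarrow> X x \<le> Y x" "AE x in M. x \<in> A \<longrightarrow> Y x \<le> X x"
    using assms(2) by auto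
  from this[THEN ext_cond_exp_mono_on[OF A]] assms(3,4)
  have "AE x in M. x \<in> A \<longrightarrow> ext_cond_exp M F X x \<le> ext_cond_exp M F Y x"
    "AE x in M. x \<in> A \<longrightarrow> ext_cond_exp M F Y x \<le> ext_cond_exp M F X x" by auto
  then show ?thesis by eventually_elim auto
qed

lemma nn_cond_exp_bounded:
  assumes "AE x in M. f x \<le> c" "f \<in> borel_measurable M"
  shows "AE x in M. nn_cond_exp M F f x \<le> c"
proof -
  have "AE x in M. nn_cond_exp M F f x \<le> nn_cond_exp M F (\<lambda>_. c) x"
    using assms by (intro nn_cond_exp_mono) auto
  moreover have "AE x in M. c = nn_cond_exp M F (\<lambda>_. c) x"
    by (rule nn_cond_exp_F_meas) simp
  ultimately show ?thesis by eventually_elim simp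
qed

text \<open>Losses are bounded below, so their conditional expectations never have the form
  \<infinity> - \<infinity>.\<close>

lemma nn_cond_exp_neg_bounded:
  assumes "\<And>x. ereal b \<le> X x" "X \<in> borel_measurable M"
  shows "AE x in M. nn_cond_exp M F (\<lambda>x. e2ennreal (- X x)) x < \<infinity>"
proof -
  note [measurable] = assms(2)
  have "e2ennreal (- X x) \<le> ennreal (- b)" for x
    using assms(1)[of x] by (cases "X x") (auto simp: e2ennreal_neg intro: ennreal_leI)
  then have "AE x in M. nn_cond_exp M F (\<lambda>x. e2ennreal (- X x)) x \<le> ennreal (- b)"
    by (intro nn_cond_exp_bounded) auto
  then show ?thesis by eventually_elim (auto simp: le_less_trans)
qed

end

lemma is_ess_inf_attained:
  assumes "is_ess_inf M \<X> v" "X \<in> \<X>" "X \<in> borel_measurable M" "\<And>Y. Y \<in> \<X> \<Longrightarrow> AE x in M. X x \<le> Y x"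
  shows "AE x in M. v x = X x"
proof -
  have "AE x in M. v x \<le> X x" "AE x in M. X x \<le> v x"
    using assms unfolding is_ess_inf_def by auto
  then show ?thesis by eventually_elim auto
qed

section \<open>One step of the recursion\<close>

text \<open>\<open>G\<close> and \<open>H\<close> stand for F (k - 1) and F k, and \<open>z\<close>
  for the quotient of the density process at k and k - 1. The assumption \<open>change\<close> is
  Bayes' formula for nonnegative variables, a form that asks for no integrability.\<close>

locale conditional_density = P: prob_space P + Q: prob_space Q
  for P Q :: "'a measure" +
  fixes G H :: "'a measure" and z :: "'a \<Rightarrow> real"
  assumes sets_eq [measurable_cong]: "sets Q = sets P"
    and ac: "absolutely_continuous P Q" "absolutely_continuous Q P"
    and subalg_H: "subalgebra P H" and subalg_G: "subalgebra H G"
    and z_measurable [measurable]: "z \<in> borel_measurable H"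
    and z_pos: "AE x in P. 0 < z x"
    and change: "X \<in> borel_measurable H \<Longrightarrow>
      AE x in P. nn_cond_exp Q G X x = nn_cond_exp P G (\<lambda>x. ennreal (z x) * X x) x"
begin

lemma AE_Q_iff: "(AE x in Q. R x) \<longleftrightarrow> (AE x in P. R x)"
  using absolutely_continuous_AE[OF sets_eq ac(1)] absolutely_continuous_AE[OF sets_eq[symmetric] ac(2)]
  by blast

lemma subalg_PG: "subalgebra P G" and subalg_QG: "subalgebra Q G"
  using subalg_H subalg_G sets_eq sets_eq_imp_space_eq[OF sets_eq]
  by (auto simp: subalgebra_def)

sublocale PG: finite_measure_subalgebra P G
  by unfold_locales (rule subalg_PG)

sublocale QG: finite_measure_subalgebra Q G
  by unfold_locales (rule subalg_QG)

lemma H_P: "f \<in> measurable H N \<Longrightarrow> f \<in> measurable P N"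
  by (rule measurable_from_subalg[OF subalg_H])

lemma G_H: "f \<in> measurable G N \<Longrightarrow> f \<in> measurable H N"
  by (rule measurable_from_subalg[OF subalg_G])

text \<open>Bayes' formula for the Lagrange weight |lam| z: the factor \<open>lam\<close> is known
  at \<open>G\<close> and comes out of the conditional expectation.\<close>

lemma nn_cond_exp_change_scaled:
  assumes lam: "lam \<in> borel_measurable G" and X: "X \<in> borel_measurable H"
  shows "AE x in P. nn_cond_exp P G (\<lambda>x. ennreal (- (lam x * z x)) * X x) x
    = ennreal (- lam x) * nn_cond_exp Q G X x"
proof -
  note [measurable] = lam lam[THEN G_H] lam[THEN G_H, THEN H_P] X X[THEN H_P] z_measurable[THEN H_P]
  have "AE x in P. ennreal (- (lam x * z x)) * X x = ennreal (- lam x) * (ennreal (z x) * X x)"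
    using z_pos
    by eventually_elim (simp add: ennreal_mult''[symmetric] mult.assoc[symmetric])
  then have "AE x in P. nn_cond_exp P G (\<lambda>x. ennreal (- (lam x * z x)) * X x) x
      = nn_cond_exp P G (\<lambda>x. ennreal (- lam x) * (ennreal (z x) * X x)) x"
    by (rule PG.nn_cond_exp_cong) measurable
  moreover have "AE x in P. ennreal (- lam x) * nn_cond_exp P G (\<lambda>x. ennreal (z x) * X x) x
      = nn_cond_exp P G (\<lambda>x. ennreal (- lam x) * (ennreal (z x) * X x)) x"
    by (rule PG.nn_cond_exp_prod) measurable
  ultimately show ?thesis using change[OF X] by eventually_elim simp
qed

end

text \<open>Since \<open>ennreal\<close> truncates at 0, \<open>ennreal r\<close> and
  \<open>ennreal (- r)\<close> are the positive and negative parts of r. Moving negative parts to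
  the other side leaves only nonnegative terms, whose conditional expectations add up without
  integrability.\<close>

lemma ennreal_pos_neg_le:
  fixes a b c d y :: real
  assumes "a + y * c \<le> b + y * d" "0 \<le> y"
  shows "(ennreal a + ennreal (- b)) + (ennreal y * ennreal c + ennreal y * ennreal (- d))
    \<le> (ennreal b + ennreal (- a)) + (ennreal y * ennreal d + ennreal y * ennreal (- c))"
proof -
  have e: "ennreal r = ennreal (max r 0)" for r by (simp add: ennreal_eq_0_iff max_def ennreal_neg)
  have m: "max r 0 - max (- r) 0 = r" for r :: real by (simp add: max_def)
  have "(max a 0 + max (- b) 0) + (y * max c 0 + y * max (- d) 0)
     \<le> (max b 0 + max (- a) 0) + (y * max d 0 + y * max (- c) 0)"
  proof -
    have "y * max c 0 - y * max (- c) 0 = y * c" "y * max d 0 - y * max (- d) 0 = y * d"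
      by (simp_all add: m right_diff_distrib[symmetric])
    then show ?thesis using assms m[of a] m[of b] by linarith
  qed
  then have "ennreal ((max a 0 + max (- b) 0) + (y * max c 0 + y * max (- d) 0))
     \<le> ennreal ((max b 0 + max (- a) 0) + (y * max d 0 + y * max (- c) 0))"
    by (rule ennreal_leI)
  then have "(ennreal (max a 0) + ennreal (max (- b) 0)) + (ennreal y * ennreal (max c 0) + ennreal y * ennreal (max (- d) 0))
     \<le> (ennreal (max b 0) + ennreal (max (- a) 0)) + (ennreal y * ennreal (max d 0) + ennreal y * ennreal (max (- c) 0))"
    using assms(2) by (simp add: ennreal_mult')
  then show ?thesis by (simp only: e[symmetric])
qed

lemma (in sigma_finite_subalgebra) nn_cond_exp_finite:
  assumes [measurable]: "f \<in> borel_measurable M" and "(\<integral>\<^sup>+x. f x \<partial>M) < \<infinity>"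
  shows "AE x in M. nn_cond_exp M F f x < \<infinity>"
proof -
  have "(\<integral>\<^sup>+x. nn_cond_exp M F f x \<partial>M) = (\<integral>\<^sup>+x. f x \<partial>M)"
    using nn_cond_exp_intg[of "\<lambda>_. 1" f] by simp
  then have "AE x in M. nn_cond_exp M F f x \<noteq> \<infinity>"
    using assms(2) by (intro nn_integral_PInf_AE) auto
  then show ?thesis by eventually_elim (simp add: less_top)
qed

text \<open>One backward step in a form that covers all times: the last one has W = -\<infinity> and
  A the whole space, the others have the candidate at k for \<open>W\<close> and the event of
  violated constraint for \<open>A\<close>. \<open>xi_deriv\<close> is the first-order condition,
  and \<open>W_pos\<close> is the invariant received from the step before.\<close>

locale optimal_step = conditional_density P Q G H z + smooth_loss l
  for P Q G H :: "'a measure" and z :: "'a \<Rightarrow> real" and l :: "real \<Rightarrow> real" +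
  fixes S lam \<xi> N :: "'a \<Rightarrow> real" and W :: "'a \<Rightarrow> ereal" and A :: "'a set" and \<alpha> :: real
  assumes S_H: "S \<in> borel_measurable H" and S_integrable: "integrable Q S"
    and W_H: "W \<in> borel_measurable H" and W_pos: "(\<integral>\<^sup>+x. e2ennreal (W x) \<partial>Q) < \<infinity>"
    and lam_G: "lam \<in> borel_measurable G" and lam_neg: "AE x in P. lam x < 0"
    and xi_H: "\<xi> \<in> borel_measurable H" and xi_deriv: "AE x in P. deriv l (\<xi> x) = lam x * z x"
    and N_H: "N \<in> borel_measurable H" and A_G: "A \<in> sets G"
    and N_on: "AE x in P. x \<in> A \<longrightarrow> ereal (N x) = max (W x) (ereal (S x + \<xi> x))"
    and N_off: "AE x in P. x \<notin> A \<longrightarrow> ereal (N x) = W x"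
    and loss_on: "AE x in P. x \<in> A \<longrightarrow>
      ext_cond_exp P G (\<lambda>x. ereal (l (N x - S x))) x = ereal \<alpha>"
    and loss_off: "AE x in P. x \<notin> A \<longrightarrow>
      ext_cond_exp P G (\<lambda>x. ereal (l (N x - S x))) x \<le> ereal \<alpha>"
begin

lemmas meas [measurable] = S_H S_H[THEN H_P] W_H W_H[THEN H_P] lam_G lam_G[THEN G_H]
  lam_G[THEN G_H, THEN H_P] xi_H xi_H[THEN H_P] N_H N_H[THEN H_P] z_measurable[THEN H_P] A_G
  A_G[THEN PG.sets_subalg] borel_loss

text \<open>The weight |lam| z equals |l'(\<xi>)|, so its product with the positive part of \<xi> is
  bounded by a constant. Bayes' formula turns the P-conditional expectation of this product into
  |lam| times the one wanted, and |lam| > 0 can be divided out.\<close>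

lemma xi_pos_finite: "AE x in P. nn_cond_exp Q G (\<lambda>x. ennreal (\<xi> x)) x < \<infinity>"
proof -
  let ?C = "l 0 - (INF x. l x)"
  have "AE x in P. ennreal (- (lam x * z x)) * ennreal (\<xi> x) \<le> ennreal ?C"
    using xi_deriv lam_neg z_pos
  proof eventually_elim
    case (elim x)
    then have "0 \<le> - (lam x * z x)" by (simp add: mult_nonpos_nonneg)
    then have "ennreal (- (lam x * z x)) * ennreal (\<xi> x) = ennreal (- (lam x * z x) * \<xi> x)"
      by (simp add: ennreal_mult'[symmetric])
    also have "\<dots> \<le> ennreal ?C"
      using deriv_mult_le[of "\<xi> x"] elim by (intro ennreal_leI) simp
    finally show ?case .
  qed
  then have "AE x in P. nn_cond_exp P G (\<lambda>x. ennreal (- (lam x * z x)) * ennreal (\<xi> x)) x \<le> ennreal ?C"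
    by (rule PG.nn_cond_exp_bounded) measurable
  moreover have "AE x in P. nn_cond_exp P G (\<lambda>x. ennreal (- (lam x * z x)) * ennreal (\<xi> x)) x
      = ennreal (- lam x) * nn_cond_exp Q G (\<lambda>x. ennreal (\<xi> x)) x"
    by (rule nn_cond_exp_change_scaled) measurable
  ultimately show ?thesis using lam_neg
  proof eventually_elim
    case (elim x)
    then have "ennreal (- lam x) * nn_cond_exp Q G (\<lambda>x. ennreal (\<xi> x)) x < \<infinity>"
      by (auto intro: le_less_trans)
    with elim(3) show ?case by (auto simp: ennreal_mult_less_top less_top[symmetric] ennreal_eq_0_iff)
  qed
qed

lemma S_pos: "(\<integral>\<^sup>+x. ennreal (S x) \<partial>Q) < \<infinity>"
  using S_integrable by (simp add: real_integrable_def less_top)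

lemma W_pos_finite: "AE x in P. nn_cond_exp Q G (\<lambda>x. e2ennreal (W x)) x < \<infinity>"
  using QG.nn_cond_exp_finite[OF _ W_pos] by (simp add: AE_Q_iff)

lemma W_finite: "AE x in P. W x < \<infinity>"
proof -
  have "AE x in Q. e2ennreal (W x) \<noteq> \<infinity>"
    using W_pos by (intro nn_integral_PInf_AE) auto
  then show ?thesis unfolding AE_Q_iff by eventually_elim auto
qed

lemma N_pos_finite: "AE x in P. nn_cond_exp Q G (\<lambda>x. ennreal (N x)) x < \<infinity>"
proof -
  let ?a = "\<lambda>x. e2ennreal (W x)" and ?b = "\<lambda>x. ennreal (S x)" and ?c = "\<lambda>x. ennreal (\<xi> x)"
  have "AE x in Q. ennreal (N x) \<le> (?a x + ?b x) + ?c x"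
    using N_on N_off unfolding AE_Q_iff
  proof eventually_elim
    case (elim x)
    have "ereal (N x) = W x \<or> N x = S x + \<xi> x"
      using elim by (auto simp: max_def split: if_splits)
    then show ?case
    proof
      assume "ereal (N x) = W x"
      then have "ennreal (N x) = ?a x" by (metis e2ennreal_ereal)
      then show ?thesis by (simp add: add.assoc)
    next
      assume "N x = S x + \<xi> x"
      then have "ennreal (N x) \<le> ?b x + ?c x"
        by (cases "0 \<le> S x"; cases "0 \<le> \<xi> x")
          (auto simp: ennreal_neg ennreal_leI simp flip: ennreal_plus)
      then show ?thesis by (simp add: add.assoc add_increasing)
    qed
  qed
  then have "AE x in Q. nn_cond_exp Q G (\<lambda>x. ennreal (N x)) x
      \<le> nn_cond_exp Q G (\<lambda>x. (?a x + ?b x) + ?c x) x"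
    by (rule QG.nn_cond_exp_mono) auto
  moreover have "AE x in Q. nn_cond_exp Q G (\<lambda>x. ?a x + ?b x) x + nn_cond_exp Q G ?c x
      = nn_cond_exp Q G (\<lambda>x. (?a x + ?b x) + ?c x) x"
    by (rule QG.nn_cond_exp_sum) auto
  moreover have "AE x in Q. nn_cond_exp Q G ?a x + nn_cond_exp Q G ?b x
      = nn_cond_exp Q G (\<lambda>x. ?a x + ?b x) x"
    by (rule QG.nn_cond_exp_sum) auto
  moreover have "AE x in Q. nn_cond_exp Q G ?b x < \<infinity>"
    using S_pos by (intro QG.nn_cond_exp_finite) auto
  ultimately show ?thesis
    using xi_pos_finite W_pos_finite unfolding AE_Q_iff
    by eventually_elim (auto simp: less_top[symmetric] top_unique)
qed

lemma loss_neg_finite: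
  assumes "M \<in> borel_measurable H"
  shows "AE x in P. nn_cond_exp P G (\<lambda>x. ennreal (- l (M x - S x))) x < \<infinity>"
  using PG.nn_cond_exp_neg_bounded[of "INF x. l x" "\<lambda>x. ereal (l (M x - S x))"]
    assms[THEN H_P] loss_lower by (simp add: ereal_less_eq(3))

lemma optimal:
  assumes M: "M \<in> borel_measurable H" and le: "AE x in P. W x \<le> ereal (M x)"
    and loss: "AE x in P. ext_cond_exp P G (\<lambda>x. ereal (l (M x - S x))) x \<le> ereal \<alpha>"
  shows "AE x in P. ext_cond_exp Q G (\<lambda>x. ereal (N x)) x \<le> ext_cond_exp Q G (\<lambda>x. ereal (M x)) x"
proof -
  note [measurable] = M M[THEN H_P]
  let ?w = "\<lambda>x. ennreal (- (lam x * z x))"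
  let ?pN = "\<lambda>x. ennreal (l (N x - S x))" and ?nN = "\<lambda>x. ennreal (- l (N x - S x))"
  let ?pM = "\<lambda>x. ennreal (l (M x - S x))" and ?nM = "\<lambda>x. ennreal (- l (M x - S x))"
  let ?N = "\<lambda>x. ennreal (N x)" and ?N' = "\<lambda>x. ennreal (- N x)"
  let ?M = "\<lambda>x. ennreal (M x)" and ?M' = "\<lambda>x. ennreal (- M x)"
  \<comment> \<open>The Lagrangian inequality: loss plus |lam| z times position is smallest at
    \<open>N\<close>. All eight terms are positive or negative parts.\<close>
  have "AE x in P. x \<in> A \<longrightarrow> (?pN x + ?nM x) + (?w x * ?N x + ?w x * ?M' x)
      \<le> (?pM x + ?nN x) + (?w x * ?M x + ?w x * ?N' x)"
    using N_on le xi_deriv lam_neg z_pos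
  proof eventually_elim
    case (elim x)
    show ?case
    proof
      assume "x \<in> A"
      with elim have N: "ereal (N x) = max (W x) (ereal (S x + \<xi> x))" by simp
      \<comment> \<open>Either the unconstrained optimizer is large enough, or \<open>N\<close>
        equals \<open>W\<close> and lies below the competitor.\<close>
      have "\<xi> x = N x - S x \<or> (\<xi> x \<le> N x - S x \<and> N x - S x \<le> M x - S x)"
      proof (cases "W x \<le> ereal (S x + \<xi> x)")
        case True
        then show ?thesis using N by (simp add: max_def)
      next
        case False
        then have "ereal (N x) = W x" using N by (simp add: max_def)
        with False elim(2) show ?thesis by (metis add_le_cancel_right diff_add_cancel ereal_less_eq(3) add.commute linear)
      qed
      from deriv_mult_diff_le[OF this] elim(3)
      have "l (N x - S x) + (- (lam x * z x)) * N x \<le> l (M x - S x) + (- (lam x * z x)) * M x"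
        by (simp add: algebra_simps)
      then show "(?pN x + ?nM x) + (?w x * ?N x + ?w x * ?M' x)
          \<le> (?pM x + ?nN x) + (?w x * ?M x + ?w x * ?N' x)"
        using elim(4,5) by (intro ennreal_pos_neg_le) (auto simp: mult_nonpos_nonneg)
    qed
  qed
  then have "AE x in P. x \<in> A \<longrightarrow>
      nn_cond_exp P G (\<lambda>x. (?pN x + ?nM x) + (?w x * ?N x + ?w x * ?M' x)) x
      \<le> nn_cond_exp P G (\<lambda>x. (?pM x + ?nN x) + (?w x * ?M x + ?w x * ?N' x)) x"
    by (intro PG.nn_cond_exp_mono_on[OF A_G]) measurable
  note 1 = this
  have sum4: "AE x in P. nn_cond_exp P G (\<lambda>x. (a x + b x) + (c x + d x)) x
     = (nn_cond_exp P G a x + nn_cond_exp P G b x) + (nn_cond_exp P G c x + nn_cond_exp P G d x)"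
    if "a \<in> borel_measurable P" "b \<in> borel_measurable P" "c \<in> borel_measurable P"
      "d \<in> borel_measurable P" for a b c d
  proof -
    note [measurable] = that
    have "AE x in P. nn_cond_exp P G (\<lambda>x. a x + b x) x + nn_cond_exp P G (\<lambda>x. c x + d x) x
      = nn_cond_exp P G (\<lambda>x. (a x + b x) + (c x + d x)) x"
      by (rule PG.nn_cond_exp_sum) measurable
    with PG.nn_cond_exp_sum[OF that(1,2)] PG.nn_cond_exp_sum[OF that(3,4)]
    show ?thesis by eventually_elim simp
  qed
  have 2: "AE x in P. nn_cond_exp P G (\<lambda>x. (?pN x + ?nM x) + (?w x * ?N x + ?w x * ?M' x)) x
     = (nn_cond_exp P G ?pN x + nn_cond_exp P G ?nM x)
      + (nn_cond_exp P G (\<lambda>x. ?w x * ?N x) x + nn_cond_exp P G (\<lambda>x. ?w x * ?M' x) x)"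
    by (rule sum4) measurable
  have 3: "AE x in P. nn_cond_exp P G (\<lambda>x. (?pM x + ?nN x) + (?w x * ?M x + ?w x * ?N' x)) x
     = (nn_cond_exp P G ?pM x + nn_cond_exp P G ?nN x)
      + (nn_cond_exp P G (\<lambda>x. ?w x * ?M x) x + nn_cond_exp P G (\<lambda>x. ?w x * ?N' x) x)"
    by (rule sum4) measurable
  have scaled: "AE x in P. nn_cond_exp P G (\<lambda>x. ?w x * ennreal (X x)) x
    = ennreal (- lam x) * nn_cond_exp Q G (\<lambda>x. ennreal (X x)) x" if "X \<in> borel_measurable H" for X
    using that by (intro nn_cond_exp_change_scaled) auto
  have on: "AE x in P. x \<in> A \<longrightarrow>
    ext_cond_exp Q G (\<lambda>x. ereal (N x)) x \<le> ext_cond_exp Q G (\<lambda>x. ereal (M x)) x"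
    using 1 2 3 scaled[OF N_H] scaled[OF M] scaled[of "\<lambda>x. - N x", OF borel_measurable_uminus[OF N_H]]
      scaled[of "\<lambda>x. - M x", OF borel_measurable_uminus[OF M]]
      loss loss_on loss_neg_finite[OF M] loss_neg_finite[OF N_H] N_pos_finite lam_neg
  proof eventually_elim
    case (elim x)
    show ?case
    proof
      assume "x \<in> A"
      with elim have eN: "enn2ereal (nn_cond_exp P G ?pN x) - enn2ereal (nn_cond_exp P G ?nN x) = ereal \<alpha>"
        and eM: "enn2ereal (nn_cond_exp P G ?pM x) - enn2ereal (nn_cond_exp P G ?nM x) \<le> ereal \<alpha>"
        by (auto simp: ext_cond_exp_def)
      have fin: "nn_cond_exp P G ?nN x \<noteq> \<top>" "nn_cond_exp P G ?nM x \<noteq> \<top>"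
        using elim by (auto simp: less_top)
      \<comment> \<open>The loss of \<open>N\<close> meets \<alpha> exactly, so it is finite; the
        cancellation below depends on this.\<close>
      have pN: "nn_cond_exp P G ?pN x \<noteq> \<top>"
        using eN fin by (cases "nn_cond_exp P G ?nN x") auto
      have "nn_cond_exp P G ?pM x + nn_cond_exp P G ?nN x \<le> nn_cond_exp P G ?pN x + nn_cond_exp P G ?nM x"
        using fin pN eM eN by (intro enn2ereal_diff_leD) auto
      moreover have "(nn_cond_exp P G ?pN x + nn_cond_exp P G ?nM x)
          + ennreal (- lam x) * (nn_cond_exp Q G ?N x + nn_cond_exp Q G ?M' x)
        \<le> (nn_cond_exp P G ?pM x + nn_cond_exp P G ?nN x)
          + ennreal (- lam x) * (nn_cond_exp Q G ?M x + nn_cond_exp Q G ?N' x)"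
        using elim(1-7) \<open>x \<in> A\<close> by (simp add: distrib_left)
      ultimately have "(nn_cond_exp P G ?pN x + nn_cond_exp P G ?nM x)
          + ennreal (- lam x) * (nn_cond_exp Q G ?N x + nn_cond_exp Q G ?M' x)
        \<le> (nn_cond_exp P G ?pN x + nn_cond_exp P G ?nM x)
          + ennreal (- lam x) * (nn_cond_exp Q G ?M x + nn_cond_exp Q G ?N' x)"
        by (meson add_right_mono order_trans)
      \<comment> \<open>The loss terms on both sides are now the same finite quantity and cancel;
        afterwards |lam| > 0 is divided out.\<close>
      then have "ennreal (- lam x) * (nn_cond_exp Q G ?N x + nn_cond_exp Q G ?M' x)
        \<le> ennreal (- lam x) * (nn_cond_exp Q G ?M x + nn_cond_exp Q G ?N' x)"
        using fin pN by (subst (asm) ennreal_add_left_cancel_le) auto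
      then have "nn_cond_exp Q G ?N x + nn_cond_exp Q G ?M' x
        \<le> nn_cond_exp Q G ?M x + nn_cond_exp Q G ?N' x"
        using \<open>lam x < 0\<close> by (subst (asm) ennreal_mult_le_mult_iff) (auto simp: ennreal_eq_0_iff)
      then show "ext_cond_exp Q G (\<lambda>x. ereal (N x)) x \<le> ext_cond_exp Q G (\<lambda>x. ereal (M x)) x"
        using elim unfolding ext_cond_exp_def
        by (intro enn2ereal_diff_mono) (auto simp: less_top)
    qed
  qed
  \<comment> \<open>Off \<open>A\<close> nothing is left to optimize, because N = W is already the
    lower bound for every competitor.\<close>
  have A': "space G - A \<in> sets G" by measurable
  have "AE x in Q. x \<in> space G - A \<longrightarrow> ereal (N x) \<le> ereal (M x)"
    using N_off le unfolding AE_Q_iff by eventually_elim auto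
  then have "AE x in Q. x \<in> space G - A \<longrightarrow>
    ext_cond_exp Q G (\<lambda>x. ereal (N x)) x \<le> ext_cond_exp Q G (\<lambda>x. ereal (M x)) x"
    by (rule QG.ext_cond_exp_mono_on[OF A']) measurable
  then have "AE x in P. x \<notin> A \<longrightarrow>
    ext_cond_exp Q G (\<lambda>x. ereal (N x)) x \<le> ext_cond_exp Q G (\<lambda>x. ereal (M x)) x"
    unfolding AE_Q_iff using AE_space
    by eventually_elim (use subalg_PG in \<open>auto simp: subalgebra_def\<close>)
  with on show ?thesis by eventually_elim blast
qed

end
text \<open>If b' and d are both infinite, the equation between the sums may leave a and a'
  undetermined. The last assumption excludes this case; it is the clause of the explicit recursion
  against -\<infinity> + \<infinity>.\<close>

lemma enn2ereal_diff_eq: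
  assumes "a + b' = a' + b + d" "a \<noteq> \<top>" "b \<noteq> \<top>"
    and "\<not> (enn2ereal b - enn2ereal b' = - \<infinity> \<and> enn2ereal d = \<infinity>)"
  shows "enn2ereal a - enn2ereal a' = (enn2ereal b - enn2ereal b') + enn2ereal d"
  using assms
  by (cases a; cases a'; cases b; cases b'; cases d)
    (auto simp flip: ennreal_plus simp: top_unique)

section \<open>Attainment of the value, the integrability invariant and the explicit formula\<close>

context optimal_step
begin

lemma N_ge: "AE x in P. W x \<le> ereal (N x)"
  using N_on N_off by eventually_elim (metis max.cobounded1 order_refl)

lemma N_loss: "AE x in P. ext_cond_exp P G (\<lambda>x. ereal (l (N x - S x))) x \<le> ereal \<alpha>"
  using loss_on loss_off by eventually_elim (metis order_refl)

text \<open>\<open>U\<close> is the value process at time k, known to agree with the candidate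
  \<open>W\<close> only almost surely.\<close>

lemma value_eq:
  assumes U: "AE x in P. U x = W x"
    and v: "is_ess_inf P {ext_cond_exp Q G (\<lambda>x. ereal (M x)) | M. M \<in> borel_measurable H \<and>
      (AE x in P. U x \<le> ereal (M x)) \<and>
      (AE x in P. ext_cond_exp P G (\<lambda>x. ereal (l (M x - S x))) x \<le> ereal \<alpha>)} v"
  shows "AE x in P. v x = ext_cond_exp Q G (\<lambda>x. ereal (N x)) x"
proof (rule is_ess_inf_attained[OF v])
  have "AE x in P. U x \<le> ereal (N x)"
    using U N_ge by eventually_elim simp
  then show "ext_cond_exp Q G (\<lambda>x. ereal (N x)) \<in> {ext_cond_exp Q G (\<lambda>x. ereal (M x)) | M.
      M \<in> borel_measurable H \<and> (AE x in P. U x \<le> ereal (M x)) \<and>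
      (AE x in P. ext_cond_exp P G (\<lambda>x. ereal (l (M x - S x))) x \<le> ereal \<alpha>)}"
    using N_H N_loss by auto
  show "ext_cond_exp Q G (\<lambda>x. ereal (N x)) \<in> borel_measurable P"
    by (rule measurable_from_subalg[OF subalg_PG]) (rule QG.borel_ext_cond_exp)
next
  fix Y assume "Y \<in> {ext_cond_exp Q G (\<lambda>x. ereal (M x)) | M. M \<in> borel_measurable H \<and>
      (AE x in P. U x \<le> ereal (M x)) \<and>
      (AE x in P. ext_cond_exp P G (\<lambda>x. ereal (l (M x - S x))) x \<le> ereal \<alpha>)}"
  then obtain M where Y: "Y = ext_cond_exp Q G (\<lambda>x. ereal (M x))"
    and M: "M \<in> borel_measurable H" "AE x in P. U x \<le> ereal (M x)"
      "AE x in P. ext_cond_exp P G (\<lambda>x. ereal (l (M x - S x))) x \<le> ereal \<alpha>" by blast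
  have "AE x in P. W x \<le> ereal (M x)"
    using U M(2) by eventually_elim simp
  then show "AE x in P. ext_cond_exp Q G (\<lambda>x. ereal (N x)) x \<le> Y x"
    unfolding Y using M by (intro optimal)
qed

text \<open>The constant reserve \<open>c\<close> is admissible; comparison with it bounds the optimal value.\<close>

lemma value_pos:
  assumes c: "l c \<le> \<alpha>"
  shows "(\<integral>\<^sup>+x. e2ennreal (ext_cond_exp Q G (\<lambda>x. ereal (N x)) x) \<partial>Q) < \<infinity>"
proof -
  \<comment> \<open>The term \<open>S x + c\<close> keeps this maximum above -\<infinity> and
    \<open>W_finite\<close> keeps it below \<infinity>, so \<open>M\<close> is a real
    position.\<close>
  define M where "M x = real_of_ereal (max (W x) (ereal (S x + c)))" for x
  have M_H [measurable]: "M \<in> borel_measurable H" "M \<in> borel_measurable P"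
    unfolding M_def[abs_def] by measurable
  have M: "AE x in P. ereal (M x) = max (W x) (ereal (S x + c))"
    using W_finite
  proof eventually_elim
    case (elim x)
    then have "max (W x) (ereal (S x + c)) \<noteq> \<infinity>" "max (W x) (ereal (S x + c)) \<noteq> - \<infinity>"
      by (auto simp: max_def)
    then show ?case by (auto simp: M_def ereal_real)
  qed
  have "AE x in P. ext_cond_exp P G (\<lambda>x. ereal (l (M x - S x))) x \<le> ereal \<alpha>"
  proof -
    have "AE x in P. x \<in> space G \<longrightarrow> ereal (l (M x - S x)) \<le> ereal \<alpha>"
      using M
    proof eventually_elim
      case (elim x)
      have "ereal (S x + c) \<le> ereal (M x)" unfolding elim by simp
      then have "l (M x - S x) \<le> l c" by (intro antimono_loss) simp
      with c show ?case by simp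
    qed
    then have "AE x in P. x \<in> space G \<longrightarrow> ext_cond_exp P G (\<lambda>x. ereal (l (M x - S x))) x
        \<le> ext_cond_exp P G (\<lambda>_. ereal \<alpha>) x"
      by (rule PG.ext_cond_exp_mono_on[OF sets.top]) measurable
    moreover have "AE x in P. ext_cond_exp P G (\<lambda>_. ereal \<alpha>) x = ereal \<alpha>"
    proof -
      have "AE x in P. real_cond_exp P G (\<lambda>_. \<alpha>) x = \<alpha>"
        by (rule PG.real_cond_exp_F_meas) auto
      moreover have "AE x in P. ext_cond_exp P G (\<lambda>_. ereal \<alpha>) x = ereal (real_cond_exp P G (\<lambda>_. \<alpha>) x)"
        by (rule PG.ext_cond_exp_integrable) simp
      ultimately show ?thesis by eventually_elim simp
    qed
    ultimately show ?thesis
      using AE_space by eventually_elim (use subalg_PG in \<open>auto simp: subalgebra_def\<close>)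
  qed
  moreover have "AE x in P. W x \<le> ereal (M x)"
    using M by eventually_elim simp
  ultimately have "AE x in Q. ext_cond_exp Q G (\<lambda>x. ereal (N x)) x \<le> ext_cond_exp Q G (\<lambda>x. ereal (M x)) x"
    unfolding AE_Q_iff by (intro optimal) auto
  \<comment> \<open>The positive part of the conditional expectation of \<open>M\<close> is at most
    the conditional expectation of its positive part.\<close>
  then have "AE x in Q. e2ennreal (ext_cond_exp Q G (\<lambda>x. ereal (N x)) x)
      \<le> nn_cond_exp Q G (\<lambda>x. ennreal (M x)) x"
  proof eventually_elim
    case (elim x)
    also have "ext_cond_exp Q G (\<lambda>x. ereal (M x)) x \<le> enn2ereal (nn_cond_exp Q G (\<lambda>x. ennreal (M x)) x)"
      by (simp add: ext_cond_exp_def ereal_diff_le_self)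
    finally show ?case by (metis e2ennreal_mono e2ennreal_enn2ereal)
  qed
  then have "(\<integral>\<^sup>+x. e2ennreal (ext_cond_exp Q G (\<lambda>x. ereal (N x)) x) \<partial>Q)
      \<le> (\<integral>\<^sup>+x. nn_cond_exp Q G (\<lambda>x. ennreal (M x)) x \<partial>Q)"
    by (rule nn_integral_mono_AE)
  also have "\<dots> = (\<integral>\<^sup>+x. ennreal (M x) \<partial>Q)"
    using QG.nn_cond_exp_intg[of "\<lambda>_. 1" "\<lambda>x. ennreal (M x)"] by simp
  also have "\<dots> \<le> (\<integral>\<^sup>+x. e2ennreal (W x) + (ennreal (S x) + ennreal c) \<partial>Q)"
  proof (rule nn_integral_mono_AE, unfold AE_Q_iff)
    show "AE x in P. ennreal (M x) \<le> e2ennreal (W x) + (ennreal (S x) + ennreal c)"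
      using M
    proof eventually_elim
      case (elim x)
      then have "ereal (M x) = W x \<or> M x = S x + c" by (auto simp: max_def split: if_splits)
      then show ?case
      proof
        assume "ereal (M x) = W x"
        then have "ennreal (M x) = e2ennreal (W x)" by (metis e2ennreal_ereal)
        then show ?thesis by simp
      next
        assume "M x = S x + c"
        then have "ennreal (M x) \<le> ennreal (S x) + ennreal c"
          by (cases "0 \<le> S x"; cases "0 \<le> c") (auto simp: ennreal_neg ennreal_leI simp flip: ennreal_plus)
        then show ?thesis by (simp add: add_increasing)
      qed
    qed
  qed
  also have "\<dots> = (\<integral>\<^sup>+x. e2ennreal (W x) \<partial>Q) + ((\<integral>\<^sup>+x. ennreal (S x) \<partial>Q) + ennreal c)"
    by (simp add: nn_integral_add Q.emeasure_space_1)
  also have "\<dots> < \<infinity>" using W_pos S_pos by simp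
  finally show ?thesis .
qed

text \<open>On \<open>A\<close>, N = W + (S - W + \<xi>)^+. Written with positive and negative parts
  on the appropriate sides, this remains true for W = -\<infinity>, where both sides are
  infinite.\<close>

lemma explicit_eq:
  defines "C \<equiv> ext_cond_exp Q G W"
    and "D \<equiv> ext_cond_exp Q G (\<lambda>x. max (ereal (S x) - W x + ereal (\<xi> x)) 0)"
  assumes ok: "AE x in P. \<not> (C x = - \<infinity> \<and> D x * indicator A x = \<infinity>)"
  shows "AE x in P. ext_cond_exp Q G (\<lambda>x. ereal (N x)) x = C x + D x * indicator A x"
proof -
  let ?d = "\<lambda>x. e2ennreal (max (ereal (S x) - W x + ereal (\<xi> x)) 0)"
  let ?w = "\<lambda>x. e2ennreal (W x)" and ?w' = "\<lambda>x. e2ennreal (- W x)"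
  let ?N = "\<lambda>x. ennreal (N x)" and ?N' = "\<lambda>x. ennreal (- N x)"
  have "AE x in Q. x \<in> A \<longrightarrow> ?N x + ?w' x = (?N' x + ?w x) + ?d x"
    using W_finite N_on unfolding AE_Q_iff
  proof eventually_elim
    case (elim x)
    show ?case
    proof
      assume "x \<in> A"
      show "?N x + ?w' x = (?N' x + ?w x) + ?d x"
      proof (cases "W x")
        case (real w)
        then have "N x = max w (S x + \<xi> x)"
          using elim \<open>x \<in> A\<close> by (auto simp: max_def split: if_splits)
        then have "max (N x) 0 + max (- w) 0 = max (- N x) 0 + max w 0 + max (S x - w + \<xi> x) 0"
          by (auto simp: max_def)
        then have "ennreal (max (N x) 0 + max (- w) 0)
            = ennreal (max (- N x) 0 + max w 0 + max (S x - w + \<xi> x) 0)" by simp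
        then have "ennreal (N x) + ennreal (- w)
            = ennreal (- N x) + ennreal w + ennreal (max (S x - w + \<xi> x) 0)"
          by (simp add: ennreal_plus)
        moreover have "?d x = ennreal (max (S x - w + \<xi> x) 0)"
          using real by (metis e2ennreal_ereal ereal_max ereal_minus(1) plus_ereal.simps(1) zero_ereal_def)
        ultimately show ?thesis using real by simp
      qed (use elim in auto)
    qed
  qed
  then have "AE x in Q. x \<in> A \<longrightarrow> nn_cond_exp Q G (\<lambda>x. ?N x + ?w' x) x
      = nn_cond_exp Q G (\<lambda>x. (?N' x + ?w x) + ?d x) x"
    by (rule QG.nn_cond_exp_cong_on[rotated]) auto
  moreover have "AE x in Q. nn_cond_exp Q G ?N x + nn_cond_exp Q G ?w' x = nn_cond_exp Q G (\<lambda>x. ?N x + ?w' x) x"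
    by (rule QG.nn_cond_exp_sum) auto
  moreover have "AE x in Q. nn_cond_exp Q G (\<lambda>x. ?N' x + ?w x) x + nn_cond_exp Q G ?d x
      = nn_cond_exp Q G (\<lambda>x. (?N' x + ?w x) + ?d x) x"
    by (rule QG.nn_cond_exp_sum) auto
  moreover have "AE x in Q. nn_cond_exp Q G ?N' x + nn_cond_exp Q G ?w x = nn_cond_exp Q G (\<lambda>x. ?N' x + ?w x) x"
    by (rule QG.nn_cond_exp_sum) auto
  \<comment> \<open>A maximum with 0 has no negative part, so \<open>D\<close> reduces to a single
    nonnegative conditional expectation.\<close>
  moreover have "AE x in Q. 0 = nn_cond_exp Q G (\<lambda>x. 0) x"
    by (rule QG.nn_cond_exp_F_meas) simp
  then have D: "AE x in Q. D x = enn2ereal (nn_cond_exp Q G ?d x)"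
    unfolding D_def ext_cond_exp_def
    by eventually_elim (simp add: e2ennreal_neg zero_ennreal.rep_eq)
  ultimately have on: "AE x in P. x \<in> A \<longrightarrow>
      ext_cond_exp Q G (\<lambda>x. ereal (N x)) x = C x + D x * indicator A x"
    using ok N_pos_finite W_pos_finite unfolding AE_Q_iff
  proof eventually_elim
    case (elim x)
    show ?case
    proof
      assume "x \<in> A"
      then show "ext_cond_exp Q G (\<lambda>x. ereal (N x)) x = C x + D x * indicator A x"
        using elim enn2ereal_diff_eq[of "nn_cond_exp Q G ?N x" "nn_cond_exp Q G ?w' x"
            "nn_cond_exp Q G ?N' x" "nn_cond_exp Q G ?w x" "nn_cond_exp Q G ?d x"]
        by (auto simp: C_def ext_cond_exp_def less_top)
    qed
  qed
  have A': "space G - A \<in> sets G" by measurable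
  have "AE x in Q. x \<in> space G - A \<longrightarrow> ereal (N x) = W x"
    using N_off unfolding AE_Q_iff by eventually_elim auto
  then have "AE x in Q. x \<in> space G - A \<longrightarrow> ext_cond_exp Q G (\<lambda>x. ereal (N x)) x = C x"
    unfolding C_def by (rule QG.ext_cond_exp_cong_on[OF A']) measurable
  with on show ?thesis
    unfolding AE_Q_iff using AE_space
    by eventually_elim (use subalg_PG in \<open>auto simp: subalgebra_def indicator_def\<close>)
qed

end

section \<open>Positivity of the density process and Bayes' formula\<close>

lemma cond_density:
  assumes P: "prob_space P" and Q: "prob_space Q" and sets: "sets Q = sets P"
    and ac: "absolutely_continuous P Q" "absolutely_continuous Q P" and F: "subalgebra P F"
  defines "Z \<equiv> real_cond_exp P F (\<lambda>x. enn2real (RN_deriv P Q x))"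
  shows "AE x in P. ennreal (Z x) = nn_cond_exp P F (RN_deriv P Q) x" and "AE x in P. 0 < Z x"
proof -
  interpret P: prob_space P by fact
  interpret Q: prob_space Q by fact
  interpret PF: finite_measure_subalgebra P F by unfold_locales (rule F)
  let ?R = "RN_deriv P Q" and ?E = "nn_cond_exp P F (RN_deriv P Q)"
  have int: "(\<integral>\<^sup>+x. f x \<partial>Q) = (\<integral>\<^sup>+x. ?R x * f x \<partial>P)" if "f \<in> borel_measurable P" for f
    using P.RN_deriv_nn_integral[OF ac(1) sets that] .
  \<comment> \<open>\<open>enn2real\<close> sends \<infinity> to 0, so the density has to be finite
    almost everywhere; this holds because \<open>Q\<close> is sigma-finite.\<close>
  have "AE x in P. ennreal (enn2real (?R x)) = ?R x"
    using P.RN_deriv_finite[OF _ ac(1) sets] Q.sigma_finite_measure_axioms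
    by (auto elim!: eventually_mono simp: less_top)
  then have 1: "AE x in P. nn_cond_exp P F (\<lambda>x. ennreal (enn2real (?R x))) x = ?E x"
    by (rule PF.nn_cond_exp_cong) auto
  have 2: "AE x in P. 0 = nn_cond_exp P F (\<lambda>x. 0) x"
    by (rule PF.nn_cond_exp_F_meas) simp
  have 3: "AE x in P. ?E x < \<infinity>"
    using int[of "\<lambda>_. 1"] by (intro PF.nn_cond_exp_finite) (auto simp: Q.emeasure_space_1)
  show Z: "AE x in P. ennreal (Z x) = ?E x"
    using 1 2 3 unfolding Z_def real_cond_exp_def
    by eventually_elim (auto simp: ennreal_neg less_top)
  \<comment> \<open>The event where the conditional density vanishes is null under \<open>Q\<close>,
    hence under \<open>P\<close> by equivalence.\<close>
  define B where "B = {x \<in> space F. ?E x = 0}"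
  have B [measurable]: "B \<in> sets F" unfolding B_def by measurable
  have B_P [measurable]: "B \<in> sets P" using B by (rule PF.sets_subalg)
  have "emeasure Q B = (\<integral>\<^sup>+x. indicator B x \<partial>Q)" using B_P sets by simp
  also have "\<dots> = (\<integral>\<^sup>+x. indicator B x * ?R x \<partial>P)" by (subst int) (auto simp: mult.commute)
  also have "\<dots> = (\<integral>\<^sup>+x. indicator B x * ?E x \<partial>P)"
    by (rule PF.nn_cond_exp_intg[symmetric]) auto
  also have "\<dots> = (\<integral>\<^sup>+x. 0 \<partial>P)" by (intro nn_integral_cong) (auto simp: B_def indicator_def)
  finally have "emeasure P B = 0"
    using absolutely_continuousD[OF ac(2)] B_P sets by simp
  then have "AE x in P. x \<notin> B" using B_P by (intro AE_not_in) (auto simp: null_sets_def)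
  then show "AE x in P. 0 < Z x"
    using Z AE_space
    by eventually_elim (use F in \<open>auto simp: B_def subalgebra_def ennreal_eq_0_iff dest: sym intro: ccontr\<close>)
qed

text \<open>Bayes' formula: \<open>E\<^sup>Q[X | G] = E\<^sup>P[X Z\<^sub>H / Z\<^sub>G | G]\<close> for \<open>H\<close>-measurable \<open>X\<close>.\<close>

lemma conditional_density_ratio:
  assumes P: "prob_space P" and Q: "prob_space Q" and sets: "sets Q = sets P"
    and ac: "absolutely_continuous P Q" "absolutely_continuous Q P"
    and H: "subalgebra P H" and G: "subalgebra H G"
  defines "R \<equiv> RN_deriv P Q"
  shows "conditional_density P Q G H
    (\<lambda>x. real_cond_exp P H (\<lambda>x. enn2real (R x)) x / real_cond_exp P G (\<lambda>x. enn2real (R x)) x)"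
    (is "conditional_density P Q G H (\<lambda>x. ?ZH x / ?ZG x)")
proof -
  interpret P: prob_space P by fact
  interpret Q: prob_space Q by fact
  have PG: "subalgebra P G" and QG: "subalgebra Q G"
    using G H sets sets_eq_imp_space_eq[OF sets] by (auto simp: subalgebra_def)
  interpret PH: finite_measure_subalgebra P H by unfold_locales (rule H)
  interpret PG: finite_measure_subalgebra P G by unfold_locales (rule PG)
  interpret QG: finite_measure_subalgebra Q G by unfold_locales (rule QG)
  note ZG = cond_density[OF P Q sets ac PG, folded R_def]
  note ZH = cond_density[OF P Q sets ac H, folded R_def]
  note [measurable_cong] = sets
  have [measurable]: "R \<in> borel_measurable P" unfolding R_def by simp
  have GH: "f \<in> borel_measurable G \<Longrightarrow> f \<in> borel_measurable H" for f :: "'a \<Rightarrow> ennreal"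
    by (rule measurable_from_subalg[OF G])
  have GHr: "f \<in> borel_measurable G \<Longrightarrow> f \<in> borel_measurable H" for f :: "'a \<Rightarrow> real"
    by (rule measurable_from_subalg[OF G])
  have HP: "f \<in> borel_measurable H \<Longrightarrow> f \<in> borel_measurable P" for f :: "'a \<Rightarrow> ennreal"
    by (rule measurable_from_subalg[OF H])
  have zH [measurable]: "(\<lambda>x. ?ZH x / ?ZG x) \<in> borel_measurable H"
    using GHr[of ?ZG] by simp
  have int: "(\<integral>\<^sup>+x. f x \<partial>Q) = (\<integral>\<^sup>+x. f x * R x \<partial>P)" if "f \<in> borel_measurable P" for f
    using P.RN_deriv_nn_integral[OF ac(1) sets that] by (simp add: R_def mult.commute)
  \<comment> \<open>The conditional densities are the densities of \<open>Q\<close> on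
    \<open>H\<close> and on \<open>G\<close>. To check the defining identity of the conditional
    expectation on an event of \<open>G\<close>, one passes from \<open>Q\<close> to
    \<open>P\<close> with the density on \<open>G\<close> and returns with the one on
    \<open>H\<close>.\<close>
  have intH: "(\<integral>\<^sup>+x. f x \<partial>Q) = (\<integral>\<^sup>+x. f x * ennreal (?ZH x) \<partial>P)" if "f \<in> borel_measurable H" for f
  proof -
    have "(\<integral>\<^sup>+x. f x \<partial>Q) = (\<integral>\<^sup>+x. f x * nn_cond_exp P H R x \<partial>P)"
      using that HP[OF that] by (simp add: int PH.nn_cond_exp_intg)
    also have "\<dots> = (\<integral>\<^sup>+x. f x * ennreal (?ZH x) \<partial>P)"
      by (rule nn_integral_cong_AE) (use ZH(1) in eventually_elim, simp)
    finally show ?thesis .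
  qed
  have intG: "(\<integral>\<^sup>+x. f x \<partial>Q) = (\<integral>\<^sup>+x. f x * ennreal (?ZG x) \<partial>P)" if "f \<in> borel_measurable G" for f
  proof -
    have "(\<integral>\<^sup>+x. f x \<partial>Q) = (\<integral>\<^sup>+x. f x * nn_cond_exp P G R x \<partial>P)"
      using that HP[OF GH[OF that]] by (simp add: int PG.nn_cond_exp_intg)
    also have "\<dots> = (\<integral>\<^sup>+x. f x * ennreal (?ZG x) \<partial>P)"
      by (rule nn_integral_cong_AE) (use ZG(1) in eventually_elim, simp)
    finally show ?thesis .
  qed
  have "AE x in P. nn_cond_exp Q G X x = nn_cond_exp P G (\<lambda>x. ennreal (?ZH x / ?ZG x) * X x) x"
    if X [measurable]: "X \<in> borel_measurable H" for X
  proof -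
    let ?Y = "nn_cond_exp P G (\<lambda>x. ennreal (?ZH x / ?ZG x) * X x)"
    have "AE x in Q. ?Y x = nn_cond_exp Q G X x"
    proof (rule QG.nn_cond_exp_charact)
      fix A assume A [measurable]: "A \<in> sets G"
      then have A_H [measurable]: "A \<in> sets H" using G by (auto simp: subalgebra_def)
      have "(\<integral>\<^sup>+x\<in>A. ?Y x \<partial>Q) = (\<integral>\<^sup>+x. (ennreal (?ZG x) * indicator A x) * ?Y x \<partial>P)"
        by (subst intG) (auto simp: ac_simps)
      also have "\<dots> = (\<integral>\<^sup>+x. (ennreal (?ZG x) * indicator A x) * (ennreal (?ZH x / ?ZG x) * X x) \<partial>P)"
      proof (rule PG.nn_cond_exp_intg)
        show "(\<lambda>x. ennreal (?ZG x) * indicator A x) \<in> borel_measurable G" by measurable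
        show "(\<lambda>x. ennreal (?ZH x / ?ZG x) * X x) \<in> borel_measurable P" by (rule HP) measurable
      qed
      also have "\<dots> = (\<integral>\<^sup>+x. (X x * indicator A x) * ennreal (?ZH x) \<partial>P)"
      proof (rule nn_integral_cong_AE)
        show "AE x in P. (ennreal (?ZG x) * indicator A x) * (ennreal (?ZH x / ?ZG x) * X x)
            = (X x * indicator A x) * ennreal (?ZH x)"
          using ZG(2) ZH(2)
        proof eventually_elim
          case (elim x)
          then have "ennreal (?ZG x) * ennreal (?ZH x / ?ZG x) = ennreal (?ZH x)"
            by (simp flip: ennreal_mult)
          moreover have "(a * i) * (b * y) = (y * i) * (a * b)" for a b i y :: ennreal
            by (simp add: ac_simps)
          ultimately show ?case by simp
        qed
      qed
      also have "\<dots> = (\<integral>\<^sup>+x\<in>A. X x \<partial>Q)" by (subst intH) auto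
      finally show "(\<integral>\<^sup>+x\<in>A. X x \<partial>Q) = (\<integral>\<^sup>+x\<in>A. ?Y x \<partial>Q)" by simp
    qed (use HP[OF X] in auto)
    then have "AE x in P. ?Y x = nn_cond_exp Q G X x"
      by (rule absolutely_continuous_AE[OF sets[symmetric] ac(2)])
    then show ?thesis by eventually_elim simp
  qed
  moreover have "AE x in P. 0 < ?ZH x / ?ZG x"
    using ZG(2) ZH(2) by eventually_elim simp
  ultimately show ?thesis
    using sets ac H G zH by unfold_locales auto
qed

section \<open>From the explicit recursion to an optimal step\<close>

lemma optimal_step_explicit:
  fixes S lam \<xi> :: "'a \<Rightarrow> real" and W :: "'a \<Rightarrow> ereal" and \<alpha> :: real
  assumes density: "conditional_density P Q G H z" and loss: "smooth_loss l"
    and S: "S \<in> borel_measurable H" "integrable Q S"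
    and W: "W \<in> borel_measurable H" "(\<integral>\<^sup>+x. e2ennreal (W x) \<partial>Q) < \<infinity>"
    and lam: "lam \<in> borel_measurable G" "AE x in P. lam x < 0"
    and xi: "\<xi> \<in> borel_measurable H" "AE x in P. deriv l (\<xi> x) = lam x * z x"
  defines "A \<equiv> {x \<in> space G. ext_cond_exp P G (\<lambda>x. ext_loss l (W x - ereal (S x))) x > ereal \<alpha>}"
  defines "N \<equiv> \<lambda>x. real_of_ereal (if x \<in> A then max (W x) (ereal (S x + \<xi> x)) else W x)"
  assumes eq: "AE x in P. x \<in> A \<longrightarrow>
    ext_cond_exp P G (\<lambda>x. ext_loss l (max (ereal (\<xi> x)) (W x - ereal (S x)))) x = ereal \<alpha>"
  shows "optimal_step P Q G H z l S lam \<xi> N W A \<alpha>"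
proof -
  interpret conditional_density P Q G H z by fact
  interpret smooth_loss l by fact
  note [measurable] = S(1) S(1)[THEN H_P] W(1) W(1)[THEN H_P] xi(1) xi(1)[THEN H_P]
  have A_G [measurable]: "A \<in> sets G" unfolding A_def by measurable
  have A_H [measurable]: "A \<in> sets H" using A_G subalg_G by (auto simp: subalgebra_def)
  have N_H [measurable]: "N \<in> borel_measurable H" unfolding N_def by measurable
  note [measurable] = N_H[THEN H_P]
  \<comment> \<open>\<open>real_of_ereal\<close> sends infinite values to 0, so \<open>N\<close> is
    the intended position only after these are excluded: \<infinity> everywhere, and -\<infinity>
    off \<open>A\<close>.\<close>
  have "AE x in Q. e2ennreal (W x) \<noteq> \<infinity>"
    using W(2) by (intro nn_integral_PInf_AE) auto
  then have W_fin: "AE x in P. W x \<noteq> \<infinity>" unfolding AE_Q_iff by eventually_elim auto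
  let ?L = "\<lambda>x. ext_loss l (W x - ereal (S x))"
  have "AE x in P. nn_cond_exp P G (\<lambda>x. e2ennreal (- ?L x)) x < \<infinity>"
    by (rule PG.nn_cond_exp_neg_bounded) (use ext_loss_lower in auto)
  moreover have "AE x in P. nn_cond_exp P G (\<lambda>x. e2ennreal (?L x)) x < \<infinity> \<longrightarrow> e2ennreal (?L x) < \<infinity>"
    by (rule PG.nn_cond_exp_finite_imp) measurable
  \<comment> \<open>Off \<open>A\<close> the conditional expected loss is at most \<alpha> and its
    negative part is finite, so its positive part is finite too. Then the loss itself is finite,
    which rules out W = -\<infinity>.\<close>
  ultimately have W_off: "AE x in P. x \<notin> A \<longrightarrow> W x \<noteq> - \<infinity>"
    using AE_space
  proof eventually_elim
    case (elim x)
    show ?case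
    proof
      assume "x \<notin> A"
      then have le: "enn2ereal (nn_cond_exp P G (\<lambda>x. e2ennreal (?L x)) x)
          - enn2ereal (nn_cond_exp P G (\<lambda>x. e2ennreal (- ?L x)) x) \<le> ereal \<alpha>"
        using elim subalg_PG by (auto simp: A_def subalgebra_def ext_cond_exp_def not_less)
      then have "nn_cond_exp P G (\<lambda>x. e2ennreal (?L x)) x < \<infinity>"
        using elim(1)
        by (cases "nn_cond_exp P G (\<lambda>x. e2ennreal (?L x)) x";
            cases "nn_cond_exp P G (\<lambda>x. e2ennreal (- ?L x)) x") auto
      with elim(2) show "W x \<noteq> - \<infinity>" by (auto simp: ext_loss_def)
    qed
  qed
  have N_on: "AE x in P. x \<in> A \<longrightarrow> ereal (N x) = max (W x) (ereal (S x + \<xi> x))"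
    using W_fin
  proof eventually_elim
    case (elim x)
    then have "\<bar>max (W x) (ereal (S x + \<xi> x))\<bar> \<noteq> \<infinity>" by (cases "W x") (auto simp: max_def)
    then show ?case by (simp add: N_def ereal_real')
  qed
  have N_off: "AE x in P. x \<notin> A \<longrightarrow> ereal (N x) = W x"
    using W_fin W_off by eventually_elim (auto simp: N_def ereal_real)
  have "AE x in P. x \<in> A \<longrightarrow> ereal (l (N x - S x)) = ext_loss l (max (ereal (\<xi> x)) (W x - ereal (S x)))"
    using N_on W_fin
  proof eventually_elim
    case (elim x)
    show ?case
    proof
      assume "x \<in> A"
      with elim have "max (ereal (\<xi> x)) (W x - ereal (S x)) = ereal (N x - S x)"
        by (cases "W x") (auto simp: max_def split: if_splits)
      then show "ereal (l (N x - S x)) = ext_loss l (max (ereal (\<xi> x)) (W x - ereal (S x)))" by simp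
    qed
  qed
  then have "AE x in P. x \<in> A \<longrightarrow> ext_cond_exp P G (\<lambda>x. ereal (l (N x - S x))) x
      = ext_cond_exp P G (\<lambda>x. ext_loss l (max (ereal (\<xi> x)) (W x - ereal (S x)))) x"
    by (rule PG.ext_cond_exp_cong_on[OF A_G]) measurable
  with eq have loss_on: "AE x in P. x \<in> A \<longrightarrow>
      ext_cond_exp P G (\<lambda>x. ereal (l (N x - S x))) x = ereal \<alpha>"
    by eventually_elim simp
  have A': "space G - A \<in> sets G" by measurable
  have "AE x in P. x \<in> space G - A \<longrightarrow> ereal (l (N x - S x)) = ?L x"
    using N_off
  proof eventually_elim
    case (elim x)
    show ?case
    proof
      assume "x \<in> space G - A"
      with elim have "W x = ereal (N x)" by simp
      then show "ereal (l (N x - S x)) = ?L x" by simp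
    qed
  qed
  then have "AE x in P. x \<in> space G - A \<longrightarrow>
      ext_cond_exp P G (\<lambda>x. ereal (l (N x - S x))) x = ext_cond_exp P G ?L x"
    by (rule PG.ext_cond_exp_cong_on[OF A']) measurable
  then have "AE x in P. x \<notin> A \<longrightarrow> ext_cond_exp P G (\<lambda>x. ereal (l (N x - S x))) x \<le> ereal \<alpha>"
    using AE_space
    by eventually_elim (use subalg_PG in \<open>auto simp: A_def subalgebra_def not_less\<close>)
  with loss_on N_on N_off show ?thesis
    using S W lam xi A_G N_H by unfold_locales
qed

section \<open>Backward induction\<close>

theorem proposition7:
  fixes P Q :: "'a measure"
    and F :: "nat \<Rightarrow> 'a measure"
    and n :: nat
    and p :: "nat \<Rightarrow> 'a \<Rightarrow> real"
    and \<alpha> :: "nat \<Rightarrow> real"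
    and l :: "real \<Rightarrow> real"
    and lam :: "nat \<Rightarrow> 'a \<Rightarrow> real"
    and V Vhat :: "nat \<Rightarrow> 'a \<Rightarrow> ereal"
  assumes "n \<ge> 1"
    and "prob_space P"
    and "\<forall>k\<le>n. subalgebra P (F k)"
    and "\<forall>j k. j \<le> k \<longrightarrow> k \<le> n \<longrightarrow> sets (F j) \<subseteq> sets (F k)"
    and "\<forall>A\<in>sets (F 0). measure P A = 0 \<or> measure P A = 1"
    and "prob_space Q" and "sets Q = sets P"
    and "absolutely_continuous P Q" and "absolutely_continuous Q P"
    and "\<forall>i\<in>{1..n}. p i \<in> borel_measurable (F i) \<and> integrable Q (p i)"
    and "strictly_convex l"
    and "\<forall>x y. x < y \<longrightarrow> l y < l x"
    and "bdd_below (range l)"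
    and "l C1_differentiable_on UNIV"
    and "filterlim (deriv l) at_bot at_bot"
    and "(deriv l \<longlongrightarrow> 0) at_top"
    and "\<forall>k\<in>{1..n}. \<alpha> k > Lim at_top l"
    and "\<forall>k\<in>{1..n}. \<exists>Y\<in>borel_measurable (F (k - 1)). (AE \<omega> in P. Y \<omega> < 0) \<and>
           integrable P (\<lambda>\<omega>. l (optimizer P Q F l k Y \<omega>))"
    and "is_value_process P Q F n (cum p) l \<alpha> V"
    and "is_explicit_process P Q F n (cum p) l \<alpha> lam Vhat"
  shows "\<forall>t<n. AE \<omega> in P. V t \<omega> = Vhat t \<omega>"
proof (intro allI impI)
  interpret smooth_loss l using assms by unfold_locales auto
  define S where "S = cum p"
  define z where "z k x = density_process P Q F k x / density_process P Q F (k - 1) x" for k x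
  define \<xi> where "\<xi> k = optimizer P Q F l k (lam (k - 1))" for k
  have sub: "subalgebra (F k) (F j)" if "j \<le> k" "k \<le> n" for j k
    using assms(3,4) that by (auto simp: subalgebra_def)
  have density: "conditional_density P Q (F (k - 1)) (F k) (z k)" if "k \<in> {1..n}" for k
    unfolding z_def[abs_def] density_process_def using that assms sub[of "k - 1" k]
    by (intro conditional_density_ratio) auto
  have S_meas: "S k \<in> borel_measurable (F k)" if "k \<le> n" for k
  proof -
    have "p i \<in> borel_measurable (F k)" if "i \<in> {1..k}" for i
      using that \<open>k \<le> n\<close> assms(10) by (intro measurable_from_subalg[OF sub[of i k]]) auto
    then show ?thesis unfolding S_def cum_def[abs_def] by (rule borel_measurable_sum)
  qed
  have S_int: "integrable Q (S k)" if "k \<le> n" for k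
    unfolding S_def cum_def[abs_def] using that assms(10) by (intro Bochner_Integration.integrable_sum) auto
  note explicit = assms(20)[unfolded is_explicit_process_def]
  have lam: "lam t \<in> borel_measurable (F t)" "AE x in P. lam t x < 0" and W: "Vhat t \<in> borel_measurable (F t)"
    if "t < n" for t
    using explicit that by auto
  have \<xi>: "\<xi> k \<in> borel_measurable (F k)" "AE x in P. deriv l (\<xi> k x) = lam (k - 1) x * z k x"
    if k: "k \<in> {1..n}" for k
  proof -
    interpret conditional_density P Q "F (k - 1)" "F k" "z k" using density[OF k] .
    have [measurable]: "lam (k - 1) \<in> borel_measurable (F k)"
      using lam(1)[of "k - 1"] k by (intro G_H) auto
    have eq: "\<xi> k = (\<lambda>x. marginal_inverse l (lam (k - 1) x * z k x))"
      by (auto simp: \<xi>_def optimizer_def z_def)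
    show "\<xi> k \<in> borel_measurable (F k)" unfolding eq by measurable
    have "AE x in P. lam (k - 1) x < 0" using k by (intro lam(2)) auto
    then show "AE x in P. deriv l (\<xi> k x) = lam (k - 1) x * z k x"
      using z_pos unfolding eq by eventually_elim (simp add: deriv_marginal_inverse mult_neg_pos)
  qed
  have c: "\<exists>c. l c \<le> \<alpha> k" if "k \<in> {1..n}" for k
    using ex_loss_less[of "\<alpha> k"] assms(17) that by (meson less_imp_le)
  have V: "is_ess_inf P
      {ext_cond_exp Q (F (k - 1)) (\<lambda>\<omega>. ereal (M \<omega>)) | M :: 'a \<Rightarrow> real.
         M \<in> borel_measurable (F k) \<and> (AE \<omega> in P. V k \<omega> \<le> ereal (M \<omega>)) \<and>
         (AE \<omega> in P. ext_cond_exp P (F (k - 1)) (\<lambda>\<omega>. ereal (l (M \<omega> - S k \<omega>))) \<omega> \<le> ereal (\<alpha> k))}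
      (V (k - 1))" if "k \<in> {1..n}" for k
    using assms(19) that unfolding is_value_process_def S_def by blast
  \<comment> \<open>Common to the base case and the induction step: the optimal position identifies
    the value at k - 1 and reproduces the integrability invariant.\<close>
  have backward: "(AE x in P. V (k - 1) x = Vhat (k - 1) x) \<and> (\<integral>\<^sup>+x. e2ennreal (Vhat (k - 1) x) \<partial>Q) < \<infinity>"
    if k: "k \<in> {1..n}" and opt: "optimal_step P Q (F (k - 1)) (F k) (z k) l (S k) (lam (k - 1)) (\<xi> k) N W A (\<alpha> k)"
      and W: "AE x in P. V k x = W x"
      and eq: "AE x in P. Vhat (k - 1) x = ext_cond_exp Q (F (k - 1)) (\<lambda>x. ereal (N x)) x" for k N W A
  proof -
    interpret optimal_step P Q "F (k - 1)" "F k" "z k" l "S k" "lam (k - 1)" "\<xi> k" N W A "\<alpha> k" by (fact opt)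
    have "AE x in P. V (k - 1) x = ext_cond_exp Q (F (k - 1)) (\<lambda>x. ereal (N x)) x"
      by (rule value_eq[OF W V[OF k]])
    with eq have "AE x in P. V (k - 1) x = Vhat (k - 1) x" by eventually_elim simp
    moreover have "(\<integral>\<^sup>+x. e2ennreal (Vhat (k - 1) x) \<partial>Q)
        = (\<integral>\<^sup>+x. e2ennreal (ext_cond_exp Q (F (k - 1)) (\<lambda>x. ereal (N x)) x) \<partial>Q)"
      by (rule nn_integral_cong_AE) (unfold AE_Q_iff, use eq in eventually_elim, simp)
    moreover obtain c where "l c \<le> \<alpha> k" using c[OF k] by blast
    ultimately show ?thesis using value_pos by simp
  qed
  fix t assume "t < n"
  then have "t \<le> n - 1" by simp
  \<comment> \<open>The integrability joins the claim because the next step back needs it as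
    \<open>W_pos\<close>. The index t plays the role of k - 1, so the induction starts at n - 1,
    that is, with k = n.\<close>
  then have "(AE x in P. V t x = Vhat t x) \<and> (\<integral>\<^sup>+x. e2ennreal (Vhat t x) \<partial>Q) < \<infinity>"
  proof (induction rule: inc_induct)
    case base
    have n: "n \<in> {1..n}" using assms(1) by simp
    interpret conditional_density P Q "F (n - 1)" "F n" "z n" using density[OF n] .
    note [measurable] = S_meas[OF order_refl] \<xi>(1)[OF n]
    \<comment> \<open>Adding and subtracting \<open>S n\<close> gives the multiplier equation the
      shape of \<open>loss_on\<close> with N = S n + \<xi> n.\<close>
    have "AE x in P. ext_cond_exp P (F (n - 1)) (\<lambda>x. ereal (l (S n x + \<xi> n x - S n x))) x = ereal (\<alpha> n)"
      using explicit by (simp add: \<xi>_def)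
    then have "optimal_step P Q (F (n - 1)) (F n) (z n) l (S n) (lam (n - 1)) (\<xi> n)
        (\<lambda>x. S n x + \<xi> n x) (\<lambda>_. - \<infinity>) (space P) (\<alpha> n)"
    proof (intro optimal_step.intro optimal_step_axioms.intro)
      show "conditional_density P Q (F (n - 1)) (F n) (z n)" by (rule density[OF n])
      show "smooth_loss l" by (rule smooth_loss_axioms)
      show "lam (n - 1) \<in> borel_measurable (F (n - 1))" "AE x in P. lam (n - 1) x < 0"
        using n by (auto intro: lam)
      show "space P \<in> sets (F (n - 1))"
        using subalg_PG by (metis sets.top subalgebra_def)
    qed (use S_meas[of n] S_int[of n] \<xi>[OF n] in \<open>simp_all add: AE_space e2ennreal_neg\<close>)
    moreover have "AE x in P. V n x = - \<infinity>"
      using assms(19) unfolding is_value_process_def by blast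
    moreover have "AE x in P. Vhat (n - 1) x = ext_cond_exp Q (F (n - 1)) (\<lambda>x. ereal (S n x + \<xi> n x)) x"
      using explicit unfolding S_def \<xi>_def by blast
    ultimately show ?case by (rule backward[OF n])
  next
    case (step m)
    define k where "k = Suc m"
    have k: "k \<in> {1..<n}" "k \<in> {1..n}" and m: "m = k - 1" using step.hyps by (auto simp: k_def)
    have IH: "AE x in P. V k x = Vhat k x" "(\<integral>\<^sup>+x. e2ennreal (Vhat k x) \<partial>Q) < \<infinity>"
      using step.IH by (auto simp: k_def)
    interpret conditional_density P Q "F (k - 1)" "F k" "z k" using density[OF k(2)] .
    let ?A = "{x \<in> space (F (k - 1)). ext_cond_exp P (F (k - 1)) (\<lambda>x. ext_loss l (Vhat k x - ereal (S k x))) x > ereal (\<alpha> k)}"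
    let ?N = "\<lambda>x. real_of_ereal (if x \<in> ?A then max (Vhat k x) (ereal (S k x + \<xi> k x)) else Vhat k x)"
    let ?C = "ext_cond_exp Q (F (k - 1)) (Vhat k)"
    let ?D = "ext_cond_exp Q (F (k - 1)) (\<lambda>x. max (ereal (S k x) - Vhat k x + ereal (\<xi> k x)) 0)"
    \<comment> \<open>This is the event as the definition writes it. Unlike \<open>?A\<close> it is
      not cut down to the underlying space, but the two indicators agree on
      \<open>space P\<close>.\<close>
    let ?A' = "{x. ext_cond_exp P (F (k - 1)) (\<lambda>x. ext_loss l (Vhat k x - ereal (S k x))) x > ereal (\<alpha> k)}"
    have ex: "AE x in P. x \<in> ?A' \<longrightarrow> ext_cond_exp P (F (k - 1))
          (\<lambda>x. ext_loss l (max (ereal (\<xi> k x)) (Vhat k x - ereal (S k x)))) x = ereal (\<alpha> k)"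
      "AE x in P. \<not> (?C x = - \<infinity> \<and> ?D x * indicator ?A' x = \<infinity>)"
      "AE x in P. Vhat (k - 1) x = ?C x + ?D x * indicator ?A' x"
      using explicit k(1) unfolding S_def \<xi>_def Let_def by blast+
    have opt: "optimal_step P Q (F (k - 1)) (F k) (z k) l (S k) (lam (k - 1)) (\<xi> k) ?N (Vhat k) ?A (\<alpha> k)"
    proof (rule optimal_step_explicit[OF density[OF k(2)]])
      show "smooth_loss l" by (rule smooth_loss_axioms)
      show "AE x in P. x \<in> ?A \<longrightarrow> ext_cond_exp P (F (k - 1))
          (\<lambda>x. ext_loss l (max (ereal (\<xi> k x)) (Vhat k x - ereal (S k x)))) x = ereal (\<alpha> k)"
        using ex(1) by eventually_elim simp
      show "lam (k - 1) \<in> borel_measurable (F (k - 1))" "AE x in P. lam (k - 1) x < 0"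
        using k(1) by (auto intro!: lam)
      show "S k \<in> borel_measurable (F k)" "integrable Q (S k)" "Vhat k \<in> borel_measurable (F k)"
        using k(1) by (auto intro: S_meas S_int W)
    qed (rule IH(2) \<xi>[OF k(2)])+
    interpret optimal_step P Q "F (k - 1)" "F k" "z k" l "S k" "lam (k - 1)" "\<xi> k" ?N "Vhat k" ?A "\<alpha> k"
      by (rule opt)
    have ind: "indicator ?A' x = (indicator ?A x :: ereal)" if "x \<in> space P" for x
      using that subalg_PG by (simp add: indicator_def subalgebra_def)
    have "AE x in P. \<not> (?C x = - \<infinity> \<and> ?D x * indicator ?A x = \<infinity>)"
      using ex(2) AE_space by eventually_elim (simp only: ind not_False_eq_True)
    from explicit_eq[OF this]
    have "AE x in P. Vhat (k - 1) x = ext_cond_exp Q (F (k - 1)) (\<lambda>x. ereal (?N x)) x"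
      using ex(3) AE_space by eventually_elim (simp only: ind)
    from backward[OF k(2) opt IH(1) this] show ?case by (simp only: m)
  qed
  then show "AE \<omega> in P. V t \<omega> = Vhat t \<omega>" by blast
qed

end
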